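(* Let $\psi:\mathbb{S}\to\mathbb{R}$ be twice continuously differentiable with exactly $N$ critical points $c_1,\dots,c_N$, $0<N<\infty$, all nondegenerate ($\psi''(c_i)\neq 0$). For $L>0$, $a\in[0,1)$ let $\tau_a(x)=a+x+L\psi(x)\pmod 1$, and for $\varepsilon>0$ consider the random map $\tau_a+Y$ with $Y$ uniformly distributed on $[-\varepsilon,\varepsilon]$. Let $C>0$ and $\beta\in(0,1]$ be constants and let $\varepsilon=\varepsilon(L)$ be a function of $L$ satisfying $\varepsilon(L)\ge C L^{\beta-1}$. Then for every sufficiently large $L$ and every $a\in[0,1)$, the random map $\tau_a+Y$ with noise level $\varepsilon=\varepsilon(L)$ admits a unique ergodic invariant measure $\mu$, and the corresponding Lyapunov exponents $\lambda_a(L)=\int_{\mathbb{S}}\log|\tau_a'|\,d\mu$ satisfy $$\liminf_{L\to\infty}\ \inf_{a\in[0,1)}\frac{\lambda_a(L)}{\log L}\ \ge\ \beta .$$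
   Context: $\mathbb{S}$ is the circle obtained by identifying the endpoints of $[0,1]$. The map $\tau_a$ depends on $L$, although this is not indicated in the notation; $\tau_a'(x)=1+L\psi'(x)$. Random map: $x\mapsto \tau_a(x)+Y \pmod 1$, with independent copies of $Y$ at each time step. For $\omega\in\mathbb{R}$ write $\tau_a^\omega(x)=\tau_a(x)+\omega \pmod 1$, and let $\eta$ be the uniform probability measure on $[-\varepsilon,\varepsilon]$. A Borel probability measure $\mu$ on $\mathbb{S}$ is invariant for $\tau_a+Y$ if $\mu(B)=\int_{[-\varepsilon,\varepsilon]}\mu((\tau_a^\omega)^{-1}B)\,d\eta(\omega)$ for every Borel set $B\subset\mathbb{S}$. An invariant measure $\mu$ is ergodic if, for every Borel set $B$, the condition $\mu(B\bigtriangleup(\tau_a^\omega)^{-1}B)=0$ for $\eta$-a.e. $\omega$ implies $\mu(B)\in\{0,1\}$. Lyapunov exponent: for i.i.d. kicks $(\omega_n)_{n\ge1}$ with law $\eta$, set $x_0=x$ and $x_n=\tau_a(x_{n-1})+\omega_n \pmod 1$. For ergodic invariant $\mu$, the limit $\lim_{n\to\infty}\frac1n\sum_{k=0}^{n-1}\log|\tau_a'(x_k)|$ is $(\eta^{\mathbb{Z}_+}\times\mu)$-a.s. equal to the constant $\lambda_a(L)=\int_{\mathbb{S}}\log|\tau_a'|\,d\mu$, which is called the Lyapunov exponent. *)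

theory Defs
  imports "HOL-Probability.Probability"
begin

(* The circle is represented by its fundamental domain [0,1); the quotient map is frac.
   The Borel sets of the circle correspond exactly to the Borel subsets of [0,1). *)
definition circle :: "real measure" where
  "circle = restrict_space borel {0..<1}"

(* Functions on the circle are represented by their 1-periodic lifts to the real line. *)
definition C2_circle_function :: "(real \<Rightarrow> real) \<Rightarrow> bool" where
  "C2_circle_function \<psi> \<longleftrightarrow>
     (\<forall>x. \<psi> (x + 1) = \<psi> x) \<and>
     (\<forall>x. \<psi> differentiable at x) \<and>
     (\<forall>x. deriv \<psi> differentiable at x) \<and>
     continuous_on UNIV (deriv (deriv \<psi>))"

definition critical_points :: "(real \<Rightarrow> real) \<Rightarrow> real set" where
  "critical_points \<psi> = {x \<in> {0..<1}. deriv \<psi> x = 0}"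

definition tau :: "(real \<Rightarrow> real) \<Rightarrow> real \<Rightarrow> real \<Rightarrow> real \<Rightarrow> real" where
  "tau \<psi> L a x = frac (a + x + L * \<psi> x)"

(* Derivative of the lift x \<mapsto> a + x + L * \<psi> x of tau; it does not depend on a. *)
definition tau_deriv :: "(real \<Rightarrow> real) \<Rightarrow> real \<Rightarrow> real \<Rightarrow> real" where
  "tau_deriv \<psi> L x = 1 + L * deriv \<psi> x"

definition tau_kicked :: "(real \<Rightarrow> real) \<Rightarrow> real \<Rightarrow> real \<Rightarrow> real \<Rightarrow> real \<Rightarrow> real" where
  "tau_kicked \<psi> L a \<omega> x = frac (tau \<psi> L a x + \<omega>)"

definition noise :: "real \<Rightarrow> real measure" where
  "noise \<epsilon> = uniform_measure lborel {-\<epsilon>..\<epsilon>}"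

definition invariant_measure ::
  "real measure \<Rightarrow> (real \<Rightarrow> real \<Rightarrow> real) \<Rightarrow> real measure \<Rightarrow> bool" where
  "invariant_measure \<eta> T \<mu> \<longleftrightarrow>
     prob_space \<mu> \<and> sets \<mu> = sets circle \<and>
     (\<forall>B\<in>sets circle.
        emeasure \<mu> B = (\<integral>\<^sup>+ \<omega>. emeasure \<mu> (T \<omega> -` B \<inter> space circle) \<partial>\<eta>))"

definition ergodic_invariant_measure ::
  "real measure \<Rightarrow> (real \<Rightarrow> real \<Rightarrow> real) \<Rightarrow> real measure \<Rightarrow> bool" where
  "ergodic_invariant_measure \<eta> T \<mu> \<longleftrightarrow>
     invariant_measure \<eta> T \<mu> \<and>
     (\<forall>B\<in>sets circle.
        (AE \<omega> in \<eta>. measure \<mu> (sym_diff B (T \<omega> -` B \<inter> space circle)) = 0) \<longrightarrow>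
        measure \<mu> B \<in> {0, 1})"

(* Logarithm of the absolute value with log 0 = -\<infinity>, whereas ln 0 = 0 in the library. *)
definition log_abs :: "real \<Rightarrow> ereal" where
  "log_abs x = (if x = 0 then -\<infinity> else ereal (ln \<bar>x\<bar>))"

(* Integral of the positive part minus integral of the negative part. When f is bounded above
   and \<mu> is finite, the first term is finite, so the difference is meaningful and lies
   in [-\<infinity>, \<infinity>). *)
definition ereal_integral :: "'a measure \<Rightarrow> ('a \<Rightarrow> ereal) \<Rightarrow> ereal" where
  "ereal_integral \<mu> f =
     enn2ereal (\<integral>\<^sup>+ x. e2ennreal (f x) \<partial>\<mu>) - enn2ereal (\<integral>\<^sup>+ x. e2ennreal (- f x) \<partial>\<mu>)"

definition lyapunov_integral :: "(real \<Rightarrow> real) \<Rightarrow> real \<Rightarrow> real measure \<Rightarrow> ereal" where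
  "lyapunov_integral \<psi> L \<mu> = ereal_integral \<mu> (\<lambda>x. log_abs (tau_deriv \<psi> L x))"

(* Meaningful when exactly one ergodic invariant measure exists. *)
definition lyapunov_exponent :: "(real \<Rightarrow> real) \<Rightarrow> real \<Rightarrow> real \<Rightarrow> real \<Rightarrow> ereal" where
  "lyapunov_exponent \<psi> \<epsilon> L a =
     lyapunov_integral \<psi> L
       (THE \<mu>. ergodic_invariant_measure (noise \<epsilon>) (tau_kicked \<psi> L a) \<mu>)"

end

theory Submission
  imports Defs "HOL-Real_Asymp.Real_Asymp"
begin

text \<open>
  Nondegeneracy and compactness give constants \<open>m, \<rho> > 0\<close> such that on every arc of length \<open>\<rho>\<close>
  either \<open>\<psi>'\<close> or \<open>\<psi>''\<close> has constant sign and absolute value at least \<open>m\<close>.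

  Unique ergodicity: by the dichotomy, an arc of length \<open>l > \<epsilon>\<close> contains a monotone branch whose
  image has length of order \<open>L l\<^sup>2\<close>, which exceeds \<open>2 l\<close> because \<open>L \<epsilon> \<ge> C L powr \<beta>\<close> is large. Hence
  finitely many steps spread an arc over the circle. One kick already spreads a point over an arc of
  length \<open>2 \<epsilon>\<close>, so the Markov chain satisfies a Doeblin condition, whence it has exactly one
  invariant measure, which is then ergodic.

  Lyapunov exponent: the invariant measure has density at most \<open>M = 1 + 1 / (2 \<epsilon>)\<close>, and by the
  dichotomy the set \<open>\<bar>\<psi>' + 1 / L\<bar> \<le> s\<close> has Lebesgue measure at most \<open>K s\<close>. The worst case is thus that
  the mass sits within distance of order \<open>1 / M\<close> of the critical points, so the integral of
  \<open>ln \<bar>\<tau>'\<bar>\<close> is at least \<open>ln (L / M) - 2 K\<close>, and \<open>L / M\<close> is of order at least \<open>L powr \<beta>\<close>.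
\<close>

section \<open>Unique ergodicity from a Doeblin condition\<close>

lemma space_circle [simp]: "space circle = {0..<1}"
  by (simp add: circle_def space_restrict_space)

text \<open>Finite additivity survives a setwise limit. Continuity at the empty set uses that the
  rate \<open>e k\<close> does not depend on the set: for \<open>A i\<close> decreasing to the empty
  set, first fix \<open>k\<close> with \<open>e k\<close> small, then use continuity of the single
  measure \<open>\<nu> k\<close>.\<close>

lemma uniform_limit_prob_space:
  fixes \<nu> :: "nat \<Rightarrow> 'a measure" and m :: "'a set \<Rightarrow> real" and e :: "nat \<Rightarrow> real"
  assumes prob: "\<And>k. prob_space (\<nu> k)" and sets: "\<And>k. sets (\<nu> k) = sets M"
    and close: "\<And>k B. B \<in> sets M \<Longrightarrow> \<bar>measure (\<nu> k) B - m B\<bar> \<le> e k"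
    and e: "e \<longlonglongrightarrow> 0"
  shows "\<exists>\<mu>. prob_space \<mu> \<and> sets \<mu> = sets M \<and> (\<forall>B\<in>sets M. measure \<mu> B = m B)"
proof -
  have lim: "(\<lambda>k. measure (\<nu> k) B) \<longlonglongrightarrow> m B" if "B \<in> sets M" for B
  proof (rule LIM_zero_cancel, rule tendsto_rabs_zero_cancel)
    show "(\<lambda>k. \<bar>measure (\<nu> k) B - m B\<bar>) \<longlonglongrightarrow> 0"
      using close[OF that] by (intro tendsto_sandwich[OF _ _ tendsto_const e]) auto
  qed
  have space: "space (\<nu> k) = space M" for k
    using sets sets_eq_imp_space_eq by blast
  have nonneg: "m B \<ge> 0" if "B \<in> sets M" for B
    using LIMSEQ_le_const[OF lim[OF that]] by auto
  have empty: "m {} = 0"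
    using LIMSEQ_unique[OF lim[of "{}"]] by auto
  have total: "m (space M) = 1"
  proof (rule LIMSEQ_unique[OF lim])
    have "measure (\<nu> k) (space M) = 1" for k
      using prob_space.prob_space[OF prob[of k]] space by simp
    then show "(\<lambda>k. measure (\<nu> k) (space M)) \<longlonglongrightarrow> 1" by simp
  qed auto
  have add: "m (A \<union> B) = m A + m B" if "A \<in> sets M" "B \<in> sets M" "A \<inter> B = {}" for A B
  proof (rule LIMSEQ_unique[OF lim])
    interpret P: prob_space "\<nu> k" for k by (rule prob)
    have "(\<lambda>k. measure (\<nu> k) A + measure (\<nu> k) B) \<longlonglongrightarrow> m A + m B"
      by (intro tendsto_add lim that)
    then show "(\<lambda>k. measure (\<nu> k) (A \<union> B)) \<longlonglongrightarrow> m A + m B"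
      using that by (simp add: P.finite_measure_Union sets)
  qed (use that in auto)
  let ?f = "\<lambda>B. ennreal (m B)"
  have ca: "countably_additive (sets M) ?f"
  proof (rule sets.empty_continuous_imp_countably_additive)
    show "positive (sets M) ?f" by (simp add: positive_def empty)
    show "additive (sets M) ?f" by (auto simp: additive_def add ennreal_plus nonneg)
    show "\<forall>A\<in>sets M. ?f A \<noteq> \<infinity>" by simp
    fix A :: "nat \<Rightarrow> 'a set" assume A: "range A \<subseteq> sets M" "decseq A" "(\<Inter>i. A i) = {}"
    have "(\<lambda>i. m (A i)) \<longlonglongrightarrow> 0"
    proof (rule LIMSEQ_I)
      fix r :: real assume "r > 0"
      then obtain k where k: "\<bar>e k\<bar> < r / 2"
        using LIMSEQ_D[OF e, of "r / 2"] by force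
      interpret prob_space "\<nu> k" by (rule prob)
      have "(\<lambda>i. measure (\<nu> k) (A i)) \<longlonglongrightarrow> measure (\<nu> k) (\<Inter>i. A i)"
        by (rule finite_Lim_measure_decseq) (use A sets in auto)
      then obtain i0 where i0: "\<And>i. i \<ge> i0 \<Longrightarrow> \<bar>measure (\<nu> k) (A i)\<bar> < r / 2"
        using LIMSEQ_D[of _ 0 "r / 2"] \<open>r > 0\<close> A(3) by force
      have "norm (m (A i) - 0) < r" if "i \<ge> i0" for i
      proof -
        have "A i \<in> sets M" using A(1) by auto
        from close[OF this, of k] i0[OF that] k show ?thesis
          unfolding real_norm_def by linarith
      qed
      then show "\<exists>i0. \<forall>i\<ge>i0. norm (m (A i) - 0) < r" by blast
    qed
    then show "(\<lambda>i. ?f (A i)) \<longlonglongrightarrow> 0"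
      using tendsto_ennrealI by fastforce
  qed
  define \<mu> where "\<mu> = measure_of (space M) (sets M) ?f"
  have sets': "sets \<mu> = sets M" by (simp add: \<mu>_def sets.space_closed)
  have emeasure: "emeasure \<mu> B = ?f B" if "B \<in> sets M" for B
    using emeasure_measure_of_sigma[OF _ _ ca that] that
    by (simp add: \<mu>_def positive_def empty sets.sigma_algebra_axioms)
  have "space \<mu> = space M" using sets' sets_eq_imp_space_eq by blast
  then have "prob_space \<mu>"
    by (intro prob_spaceI) (simp add: emeasure total)
  moreover have "\<forall>B\<in>sets M. measure \<mu> B = m B"
    by (simp add: emeasure measure_def nonneg)
  ultimately show ?thesis using sets' by blast
qed

section \<open>One step of the chain, acting on laws and on functions\<close>

locale random_circle_map = prob_space \<eta> for \<eta> :: "real measure" +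
  fixes T :: "real \<Rightarrow> real \<Rightarrow> real"
  assumes T_measurable [measurable]: "(\<lambda>(\<omega>, x). T \<omega> x) \<in> \<eta> \<Otimes>\<^sub>M circle \<rightarrow>\<^sub>M circle"
begin

definition push :: "real measure \<Rightarrow> real measure" where
  "push \<mu> = distr (\<eta> \<Otimes>\<^sub>M \<mu>) circle (\<lambda>(\<omega>, x). T \<omega> x)"

text \<open>The Markov operator on functions, dual to \<open>push\<close> by
  \<open>nn_integral_push\<close>. Values in \<open>ennreal\<close> keep integrability conditions
  away.\<close>

definition transfer :: "(real \<Rightarrow> ennreal) \<Rightarrow> real \<Rightarrow> ennreal" where
  "transfer f x = (\<integral>\<^sup>+ \<omega>. f (T \<omega> x) \<partial>\<eta>)"

lemma T_sections [measurable]: "x \<in> {0..<1} \<Longrightarrow> (\<lambda>\<omega>. T \<omega> x) \<in> \<eta> \<rightarrow>\<^sub>M circle"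
  using measurable_Pair_compose_split[OF T_measurable, of "\<lambda>\<omega>. \<omega>" \<eta> "\<lambda>_. x"] by simp

lemma T_sections' [measurable]: "\<omega> \<in> space \<eta> \<Longrightarrow> T \<omega> \<in> circle \<rightarrow>\<^sub>M circle"
  using measurable_Pair_compose_split[OF T_measurable, of "\<lambda>_. \<omega>" circle "\<lambda>x. x"] by simp

lemma transfer_measurable [measurable]:
  assumes [measurable]: "f \<in> borel_measurable circle"
  shows "transfer f \<in> borel_measurable circle"
proof -
  have "(\<lambda>x. \<integral>\<^sup>+ \<omega>. f ((\<lambda>(\<omega>, x). T \<omega> x) (\<omega>, x)) \<partial>\<eta>) \<in> borel_measurable circle"
    by measurable
  then show ?thesis by (simp add: transfer_def[abs_def])
qed

lemma transfer_iter_measurable [measurable]: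
  "f \<in> borel_measurable circle \<Longrightarrow> (transfer ^^ n) f \<in> borel_measurable circle"
  by (induction n) auto

lemma sets_push [simp, measurable_cong]: "sets (push \<mu>) = sets circle"
  by (simp add: push_def)

lemma T_measurable':
  assumes "sets \<mu> = sets circle"
  shows "(\<lambda>(\<omega>, x). T \<omega> x) \<in> \<eta> \<Otimes>\<^sub>M \<mu> \<rightarrow>\<^sub>M circle"
proof -
  have "sets (\<eta> \<Otimes>\<^sub>M \<mu>) = sets (\<eta> \<Otimes>\<^sub>M circle)"
    using assms by (intro sets_pair_measure_cong) auto
  then show ?thesis using T_measurable measurable_cong_sets by blast
qed

lemma prob_space_push:
  assumes "prob_space \<mu>" "sets \<mu> = sets circle"
  shows "prob_space (push \<mu>)"
proof -
  interpret \<mu>: prob_space \<mu> by fact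
  interpret pair_prob_space \<eta> \<mu> ..
  show ?thesis unfolding push_def
    by (rule P.prob_space_distr, rule T_measurable'[OF assms(2)])
qed

lemma nn_integral_push:
  assumes "prob_space \<mu>" and sets: "sets \<mu> = sets circle"
    and f: "f \<in> borel_measurable circle"
  shows "(\<integral>\<^sup>+ x. f x \<partial>push \<mu>) = (\<integral>\<^sup>+ x. transfer f x \<partial>\<mu>)"
proof -
  interpret \<mu>: prob_space \<mu> by fact
  interpret pair_sigma_finite \<eta> \<mu> ..
  have m: "(\<lambda>z. f (case z of (\<omega>, x) \<Rightarrow> T \<omega> x)) \<in> borel_measurable (\<eta> \<Otimes>\<^sub>M \<mu>)"
    using measurable_compose[OF T_measurable'[OF sets] f] .
  have "(\<integral>\<^sup>+ x. f x \<partial>push \<mu>) = (\<integral>\<^sup>+ z. f (case z of (\<omega>, x) \<Rightarrow> T \<omega> x) \<partial>(\<eta> \<Otimes>\<^sub>M \<mu>))"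
    unfolding push_def by (rule nn_integral_distr) (use T_measurable'[OF sets] f in auto)
  also have "\<dots> = (\<integral>\<^sup>+ x. transfer f x \<partial>\<mu>)"
    using nn_integral_snd[OF m] by (simp add: transfer_def)
  finally show ?thesis .
qed

lemma emeasure_push:
  assumes "prob_space \<mu>" and sets: "sets \<mu> = sets circle" and B: "B \<in> sets circle"
  shows "emeasure (push \<mu>) B = (\<integral>\<^sup>+ \<omega>. emeasure \<mu> (T \<omega> -` B \<inter> space circle) \<partial>\<eta>)"
proof -
  interpret \<mu>: prob_space \<mu> by fact
  have sp: "space \<mu> = space circle" using sets sets_eq_imp_space_eq by blast
  let ?X = "(\<lambda>(\<omega>, x). T \<omega> x) -` B \<inter> space (\<eta> \<Otimes>\<^sub>M \<mu>)"
  have "emeasure (push \<mu>) B = emeasure (\<eta> \<Otimes>\<^sub>M \<mu>) ?X"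
    unfolding push_def by (rule emeasure_distr[OF T_measurable'[OF sets] B])
  also have "\<dots> = (\<integral>\<^sup>+ \<omega>. emeasure \<mu> (Pair \<omega> -` ?X) \<partial>\<eta>)"
    using T_measurable'[OF sets] B by (intro \<mu>.emeasure_pair_measure_alt) (rule measurable_sets)
  also have "\<dots> = (\<integral>\<^sup>+ \<omega>. emeasure \<mu> (T \<omega> -` B \<inter> space circle) \<partial>\<eta>)"
    by (intro nn_integral_cong arg_cong[of _ _ "emeasure \<mu>"]) (auto simp: space_pair_measure sp)
  finally show ?thesis .
qed

lemma invariant_iff_push:
  "invariant_measure \<eta> T \<mu> \<longleftrightarrow> prob_space \<mu> \<and> sets \<mu> = sets circle \<and> push \<mu> = \<mu>"
proof
  assume *: "invariant_measure \<eta> T \<mu>"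
  then have "push \<mu> = \<mu>"
    by (intro measure_eqI) (auto simp: invariant_measure_def emeasure_push)
  with * show "prob_space \<mu> \<and> sets \<mu> = sets circle \<and> push \<mu> = \<mu>"
    by (simp add: invariant_measure_def)
next
  assume *: "prob_space \<mu> \<and> sets \<mu> = sets circle \<and> push \<mu> = \<mu>"
  then show "invariant_measure \<eta> T \<mu>"
    using emeasure_push[of \<mu>] by (auto simp: invariant_measure_def)
qed

lemma push_iter:
  assumes "prob_space \<mu>" "sets \<mu> = sets circle"
  shows "prob_space ((push ^^ n) \<mu>)" "sets ((push ^^ n) \<mu>) = sets circle"
    "f \<in> borel_measurable circle \<Longrightarrow>
       (\<integral>\<^sup>+ x. f x \<partial>(push ^^ n) \<mu>) = (\<integral>\<^sup>+ x. (transfer ^^ n) f x \<partial>\<mu>)"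
proof -
  have *: "prob_space ((push ^^ n) \<mu>) \<and> sets ((push ^^ n) \<mu>) = sets circle" for n
    by (induction n) (auto simp: assms prob_space_push)
  then show "prob_space ((push ^^ n) \<mu>)" "sets ((push ^^ n) \<mu>) = sets circle" by auto
  show "(\<integral>\<^sup>+ x. f x \<partial>(push ^^ n) \<mu>) = (\<integral>\<^sup>+ x. (transfer ^^ n) f x \<partial>\<mu>)"
    if "f \<in> borel_measurable circle" using that
  proof (induction n arbitrary: f)
    case (Suc n)
    have "(\<integral>\<^sup>+ x. f x \<partial>(push ^^ Suc n) \<mu>) = (\<integral>\<^sup>+ x. transfer f x \<partial>(push ^^ n) \<mu>)"
      using * Suc.prems by (simp add: nn_integral_push)
    also have "\<dots> = (\<integral>\<^sup>+ x. (transfer ^^ n) (transfer f) x \<partial>\<mu>)"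
      by (rule Suc.IH) (use Suc.prems in simp)
    finally show ?case by (simp add: funpow_swap1)
  qed simp
qed

text \<open>Orbits never leave [0,1), so a decomposition of \<open>h\<close> valid there is enough.
  This lets truncated differences such as \<open>f y - ennreal c\<close>, which are true differences
  only where \<open>ennreal c \<le> f y\<close>, be handled through sums.\<close>

lemma transfer_iter_add:
  assumes [measurable]: "f \<in> borel_measurable circle" "g \<in> borel_measurable circle"
    and "x \<in> {0..<1}" and h: "\<And>y. y \<in> {0..<1} \<Longrightarrow> h y = f y + g y"
  shows "(transfer ^^ n) h x = (transfer ^^ n) f x + (transfer ^^ n) g x"
  using \<open>x \<in> {0..<1}\<close>
proof (induction n arbitrary: x)
  case (Suc n)
  note [measurable] = T_sections[OF Suc.prems]
  have "T \<omega> x \<in> {0..<1}" if "\<omega> \<in> space \<eta>" for \<omega>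
    using measurable_space[OF T_sections[OF Suc.prems] that] by simp
  then have "(transfer ^^ Suc n) h x =
      (\<integral>\<^sup>+ \<omega>. (transfer ^^ n) f (T \<omega> x) + (transfer ^^ n) g (T \<omega> x) \<partial>\<eta>)"
    unfolding funpow.simps o_def transfer_def[of "(transfer ^^ n) h"]
    by (intro nn_integral_cong Suc.IH)
  also have "\<dots> = (transfer ^^ Suc n) f x + (transfer ^^ Suc n) g x"
    unfolding funpow.simps o_def transfer_def[of "(transfer ^^ n) f"] transfer_def[of "(transfer ^^ n) g"]
    by (intro nn_integral_add measurable_compose[OF T_sections[OF Suc.prems]]) measurable
  finally show ?case .
qed (use h in simp)

lemma transfer_iter_const:
  assumes "x \<in> {0..<1}" and h: "\<And>y. y \<in> {0..<1} \<Longrightarrow> h y = c"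
  shows "(transfer ^^ n) h x = c"
  using \<open>x \<in> {0..<1}\<close>
proof (induction n arbitrary: x)
  case (Suc n)
  have "T \<omega> x \<in> {0..<1}" if "\<omega> \<in> space \<eta>" for \<omega>
    using measurable_space[OF T_sections[OF Suc.prems] that] by simp
  then have "(transfer ^^ Suc n) h x = (\<integral>\<^sup>+ \<omega>. c \<partial>\<eta>)"
    unfolding funpow.simps o_def transfer_def[of "(transfer ^^ n) h"]
    by (intro nn_integral_cong Suc.IH)
  then show ?case by (simp add: emeasure_space_1)
qed (use h in simp)

end

section \<open>Contraction, uniqueness and existence under a minorization\<close>

locale doeblin_circle_map = random_circle_map +
  fixes \<nu> :: "real measure" and n :: nat and \<delta> :: real
  assumes prob_\<nu>: "prob_space \<nu>" and sets_\<nu> [measurable_cong]: "sets \<nu> = sets circle"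
    and \<delta>_pos: "\<delta> > 0"
    and minorization: "\<And>f x. f \<in> borel_measurable circle \<Longrightarrow> x \<in> {0..<1} \<Longrightarrow>
          (transfer ^^ n) f x \<ge> ennreal \<delta> * (\<integral>\<^sup>+ y. f y \<partial>\<nu>)"
begin

lemma \<delta>_le_1: "\<delta> \<le> 1"
proof -
  have "ennreal \<delta> * (\<integral>\<^sup>+ y. 1 \<partial>\<nu>) \<le> (transfer ^^ n) (\<lambda>_. 1) 0"
    by (rule minorization) auto
  also have "\<dots> = 1" by (rule transfer_iter_const) auto
  finally show ?thesis
    using \<delta>_pos prob_space.emeasure_space_1[OF prob_\<nu>] by simp
qed

text \<open>The \<^term>\<open>n\<close>-step transition probabilities share the common part \<open>\<delta> \<nu>\<close>, so that averaging
  contracts the oscillation of a function by the factor \<open>1 - \<delta>\<close>.\<close>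
lemma transfer_oscillation:
  assumes f [measurable]: "f \<in> borel_measurable circle" and "0 \<le> c" "c \<le> d"
    and bounds: "\<And>x. x \<in> {0..<1} \<Longrightarrow> ennreal c \<le> f x \<and> f x \<le> ennreal d"
  shows "\<exists>c' d'. 0 \<le> c' \<and> c' \<le> d' \<and> d' - c' = (1 - \<delta>) * (d - c) \<and>
     (\<forall>x\<in>{0..<1}. ennreal c' \<le> (transfer ^^ n) f x \<and> (transfer ^^ n) f x \<le> ennreal d')"
proof -
  interpret \<nu>: prob_space \<nu> by (rule prob_\<nu>)
  have sp: "space \<nu> = {0..<1}" using sets_eq_imp_space_eq[OF sets_\<nu>] by simp
  \<comment> \<open>\<open>I\<close> and \<open>J\<close> are the \<open>\<nu>\<close>-averages of
    the distances of \<open>f\<close> from its lower and its upper bound. They add up to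
    \<open>d - c\<close>, so raising the lower bound by \<open>\<delta> * i\<close> and lowering the
    upper one by \<open>\<delta> * j\<close> shrinks the gap by exactly the factor
    \<open>1 - \<delta>\<close>.\<close>
  define I where "I = (\<integral>\<^sup>+ y. f y - ennreal c \<partial>\<nu>)"
  define J where "J = (\<integral>\<^sup>+ y. ennreal d - f y \<partial>\<nu>)"
  have IJ: "I + J = ennreal (d - c)"
  proof -
    have "I + J = (\<integral>\<^sup>+ y. (f y - ennreal c) + (ennreal d - f y) \<partial>\<nu>)"
      unfolding I_def J_def by (rule nn_integral_add[symmetric]) measurable
    also have "\<dots> = (\<integral>\<^sup>+ y. ennreal (d - c) \<partial>\<nu>)"
    proof (rule nn_integral_cong)
      fix y assume "y \<in> space \<nu>"
      then have b: "ennreal c \<le> f y" "f y \<le> ennreal d" using bounds sp by auto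
      then obtain r where "f y = ennreal r" "r \<ge> 0" by (cases "f y") (auto simp: top_unique)
      then show "(f y - ennreal c) + (ennreal d - f y) = ennreal (d - c)"
        using b assms(2,3) by (auto simp: ennreal_minus simp flip: ennreal_plus)
    qed
    finally show ?thesis by (simp add: \<nu>.emeasure_space_1)
  qed
  then have "I \<noteq> \<top>" "J \<noteq> \<top>" by auto
  then obtain i j where i: "I = ennreal i" "i \<ge> 0" and j: "J = ennreal j" "j \<ge> 0"
    by (cases I; cases J) auto
  have ij: "i + j = d - c" using IJ i j assms(3) by (simp flip: ennreal_plus)
  have \<delta>ij: "\<delta> * i + \<delta> * j = \<delta> * (d - c)" "\<delta> * j \<le> d - c"
    using ij \<delta>_le_1 \<delta>_pos i j mult_left_le_one_le[of j \<delta>] by (auto simp flip: distrib_left)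
  show ?thesis
  proof (rule exI[of _ "c + \<delta> * i"], rule exI[of _ "d - \<delta> * j"], intro conjI ballI)
    show "0 \<le> c + \<delta> * i" using assms(2) \<delta>_pos i by simp
    show "d - \<delta> * j - (c + \<delta> * i) = (1 - \<delta>) * (d - c)" using \<delta>ij by argo
    then show "c + \<delta> * i \<le> d - \<delta> * j"
      using \<delta>_le_1 assms(3) by (smt (verit) mult_nonneg_nonneg)
    fix x :: real assume x: "x \<in> {0..<1}"
    have "(transfer ^^ n) f x = (transfer ^^ n) (\<lambda>_. ennreal c) x + (transfer ^^ n) (\<lambda>y. f y - ennreal c) x"
      by (rule transfer_iter_add) (use x bounds in \<open>auto simp: add_diff_inverse_ennreal\<close>)
    moreover have "(transfer ^^ n) (\<lambda>y. f y - ennreal c) x \<ge> ennreal \<delta> * I"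
      unfolding I_def by (rule minorization) (use x in auto)
    ultimately show "ennreal (c + \<delta> * i) \<le> (transfer ^^ n) f x"
      using i \<delta>_pos assms(2) x by (simp add: transfer_iter_const ennreal_plus ennreal_mult)
    \<comment> \<open>The minorization bounds from below only; the upper bound comes from applying
      it to the complementary function \<open>d - f\<close>.\<close>
    have "ennreal d = (transfer ^^ n) (\<lambda>_. ennreal d) x"
      using x by (simp add: transfer_iter_const)
    also have "\<dots> = (transfer ^^ n) f x + (transfer ^^ n) (\<lambda>y. ennreal d - f y) x"
      by (rule transfer_iter_add) (use x bounds in \<open>auto simp: add_diff_inverse_ennreal\<close>)
    finally have eq: "ennreal d = (transfer ^^ n) f x + (transfer ^^ n) (\<lambda>y. ennreal d - f y) x" .
    have ge: "(transfer ^^ n) (\<lambda>y. ennreal d - f y) x \<ge> ennreal \<delta> * J"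
      unfolding J_def by (rule minorization) (use x in auto)
    have "ennreal \<delta> * J = ennreal (\<delta> * j)"
      using j \<delta>_pos by (simp add: ennreal_mult)
    with ge have "(transfer ^^ n) f x + ennreal (\<delta> * j) \<le>
        (transfer ^^ n) f x + (transfer ^^ n) (\<lambda>y. ennreal d - f y) x"
      by (intro add_left_mono) simp
    also note eq[symmetric]
    finally have "(transfer ^^ n) f x + ennreal (\<delta> * j) \<le> ennreal d" .
    then show "(transfer ^^ n) f x \<le> ennreal (d - \<delta> * j)"
      using \<delta>_pos j order_trans[OF assms(2,3)]
      by (cases "(transfer ^^ n) f x") (auto simp: top_unique ennreal_le_iff simp flip: ennreal_plus)
  qed
qed

lemma transfer_iter_oscillation:
  assumes "B \<in> sets circle"
  shows "\<exists>c d. 0 \<le> c \<and> c \<le> d \<and> d - c = (1 - \<delta>) ^ k \<and> (\<forall>x\<in>{0..<1}.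
     ennreal c \<le> (transfer ^^ (n * k)) (indicator B) x \<and>
     (transfer ^^ (n * k)) (indicator B) x \<le> ennreal d)"
proof (induction k)
  case 0
  show ?case
    by (intro exI[of _ 0] exI[of _ 1]) (auto simp: indicator_def)
next
  case (Suc k)
  then obtain c d where cd: "0 \<le> c" "c \<le> d" "d - c = (1 - \<delta>) ^ k"
    "\<And>x. x \<in> {0..<1} \<Longrightarrow> ennreal c \<le> (transfer ^^ (n * k)) (indicator B) x \<and>
     (transfer ^^ (n * k)) (indicator B) x \<le> ennreal d" by blast
  have "(transfer ^^ (n * Suc k)) (indicator B) =
      (transfer ^^ n) ((transfer ^^ (n * k)) (indicator B))"
    by (simp add: funpow_add)
  then show ?case
    using transfer_oscillation[OF _ cd(1,2,4)] cd(3) assms by simp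
qed

text \<open>Both masses are averages of the single function
  \<open>(transfer ^^ (n * k)) (indicator B)\<close> over the respective initial laws, so both lie
  in an interval of length \<open>(1 - \<delta>) ^ k\<close> that contains its values.\<close>

lemma push_iter_close:
  assumes "prob_space \<mu>" "sets \<mu> = sets circle" "prob_space \<mu>'" "sets \<mu>' = sets circle"
    and B: "B \<in> sets circle"
  shows "\<bar>measure ((push ^^ (n * k)) \<mu>) B - measure ((push ^^ (n * k)) \<mu>') B\<bar> \<le> (1 - \<delta>) ^ k"
proof -
  obtain c d where cd: "0 \<le> c" "c \<le> d" "d - c = (1 - \<delta>) ^ k"
    "\<And>x. x \<in> {0..<1} \<Longrightarrow> ennreal c \<le> (transfer ^^ (n * k)) (indicator B) x \<and>
     (transfer ^^ (n * k)) (indicator B) x \<le> ennreal d"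
    using transfer_iter_oscillation[OF B] by blast
  have "c \<le> measure ((push ^^ (n * k)) \<mu>) B \<and> measure ((push ^^ (n * k)) \<mu>) B \<le> d"
    if \<mu>: "prob_space \<mu>" "sets \<mu> = sets circle" for \<mu>
  proof -
    interpret \<mu>: prob_space \<mu> by (rule \<mu>)
    interpret P: prob_space "(push ^^ (n * k)) \<mu>" by (rule push_iter[OF \<mu>])
    have sp: "space \<mu> = {0..<1}" using sets_eq_imp_space_eq[OF \<mu>(2)] by simp
    have eq: "emeasure ((push ^^ (n * k)) \<mu>) B = (\<integral>\<^sup>+ x. (transfer ^^ (n * k)) (indicator B) x \<partial>\<mu>)"
      using push_iter(3)[OF \<mu>, of "indicator B" "n * k"] push_iter(2)[OF \<mu>] B by simp
    have "(\<integral>\<^sup>+ x. ennreal c \<partial>\<mu>) \<le> emeasure ((push ^^ (n * k)) \<mu>) B"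
      unfolding eq by (rule nn_integral_mono) (use cd sp in auto)
    moreover have "emeasure ((push ^^ (n * k)) \<mu>) B \<le> (\<integral>\<^sup>+ x. ennreal d \<partial>\<mu>)"
      unfolding eq by (rule nn_integral_mono) (use cd sp in auto)
    ultimately show ?thesis
      using cd(1,2) by (simp add: \<mu>.emeasure_space_1 P.emeasure_eq_measure)
  qed
  from this[OF assms(1,2)] this[OF assms(3,4)] cd(3) show ?thesis by linarith
qed

lemma contraction_tendsto: "(\<lambda>k. (1 - \<delta>) ^ k) \<longlonglongrightarrow> 0"
  using \<delta>_pos \<delta>_le_1 by (intro LIMSEQ_power_zero) simp

lemma invariant_unique:
  assumes "invariant_measure \<eta> T \<mu>" "invariant_measure \<eta> T \<mu>'"
  shows "\<mu> = \<mu>'"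
proof (rule measure_eqI)
  have \<mu>: "prob_space \<mu>" "sets \<mu> = sets circle" "push \<mu> = \<mu>"
    and \<mu>': "prob_space \<mu>'" "sets \<mu>' = sets circle" "push \<mu>' = \<mu>'"
    using assms by (auto simp: invariant_iff_push)
  then show "sets \<mu> = sets \<mu>'" by simp
  have fp: "(push ^^ k) \<mu> = \<mu>" "(push ^^ k) \<mu>' = \<mu>'" for k
    by (induction k) (auto simp: \<mu>(3) \<mu>'(3))
  fix B assume "B \<in> sets \<mu>"
  then have "\<bar>measure \<mu> B - measure \<mu>' B\<bar> \<le> (1 - \<delta>) ^ k" for k
    using push_iter_close[OF \<mu>(1,2) \<mu>'(1,2), of B k] \<mu>(2) by (simp add: fp)
  then have "\<bar>measure \<mu> B - measure \<mu>' B\<bar> \<le> 0"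
    using LIMSEQ_le_const[OF contraction_tendsto] by blast
  then show "emeasure \<mu> B = emeasure \<mu>' B"
    using \<mu>(1) \<mu>'(1) by (simp add: prob_space_def finite_measure.emeasure_eq_measure)
qed

text \<open>The laws \<open>P k\<close> are Cauchy uniformly over events, so their limit is a
  measure. It is fixed by \<open>push\<close> itself, and not only by the \<open>n\<close>-th
  iterate, because one step does not increase the uniform distance and because the chains started
  from \<open>\<nu>\<close> and from \<open>push \<nu>\<close> merge.\<close>

lemma invariant_exists: "\<exists>\<mu>. invariant_measure \<eta> T \<mu>"
proof -
  define P where "P k = (push ^^ (n * k)) \<nu>" for k
  have P: "prob_space (P k)" "sets (P k) = sets circle" for k
    unfolding P_def by (rule push_iter[OF prob_\<nu> sets_\<nu>])+
  \<comment> \<open>\<open>P (k + j)\<close> is the law after \<open>n * k\<close> steps from the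
    start \<open>P j\<close>, compared here with the start \<open>\<nu>\<close>.\<close>
  have close: "\<bar>measure (P k) B - measure (P (k + j)) B\<bar> \<le> (1 - \<delta>) ^ k"
    if "B \<in> sets circle" for k j B
    using push_iter_close[OF prob_\<nu> sets_\<nu> P[of j] that, of k]
    by (simp add: P_def funpow_add distrib_left)
  have Cauchy: "convergent (\<lambda>k. measure (P k) B)" if B: "B \<in> sets circle" for B
  proof (rule real_Cauchy_convergent, rule CauchyI')
    fix e :: real assume "e > 0"
    then obtain M where "(1 - \<delta>) ^ M < e"
      using LIMSEQ_D[OF contraction_tendsto, of e] by (auto simp: abs_less_iff)
    have "dist (measure (P k) B) (measure (P l) B) < e" if "M \<le> k" "k < l" for k l
    proof -
      have "(1 - \<delta>) ^ k \<le> (1 - \<delta>) ^ M"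
        using that \<delta>_pos \<delta>_le_1 by (intro power_decreasing) auto
      then show ?thesis
        using close[OF B, of k "l - k"] that \<open>(1 - \<delta>) ^ M < e\<close> by (simp add: dist_real_def)
    qed
    then show "\<exists>M. \<forall>m\<ge>M. \<forall>n>m. dist (measure (P m) B) (measure (P n) B) < e" by blast
  qed
  define m where "m B = lim (\<lambda>k. measure (P k) B)" for B
  have m: "\<bar>measure (P k) B - m B\<bar> \<le> (1 - \<delta>) ^ k" if B: "B \<in> sets circle" for k B
  proof -
    have "(\<lambda>j. measure (P (j + k)) B) \<longlonglongrightarrow> m B"
      using Cauchy[OF B] unfolding m_def convergent_LIMSEQ_iff by (rule LIMSEQ_ignore_initial_segment)
    then have "(\<lambda>j. \<bar>measure (P k) B - measure (P (j + k)) B\<bar>) \<longlonglongrightarrow> \<bar>measure (P k) B - m B\<bar>"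
      by (intro tendsto_intros)
    then show ?thesis
      using close[OF B, of k] by (auto intro!: LIMSEQ_le_const2 simp: add.commute)
  qed
  obtain \<mu> where \<mu>: "prob_space \<mu>" "sets \<mu> = sets circle"
    and \<mu>_eq: "\<And>B. B \<in> sets circle \<Longrightarrow> measure \<mu> B = m B"
    using uniform_limit_prob_space[OF P m contraction_tendsto] by blast
  interpret \<mu>: prob_space \<mu> by (rule \<mu>)
  interpret P: prob_space "P k" for k by (rule P)
  interpret Q: prob_space "push (P k)" for k by (rule prob_space_push[OF P])
  interpret p\<mu>: prob_space "push \<mu>" by (rule prob_space_push[OF \<mu>])
  have "push \<mu> = \<mu>"
  proof (rule measure_eqI)
    fix B assume "B \<in> sets (push \<mu>)"
    then have B: "B \<in> sets circle" by simp
    \<comment> \<open>Three distances of at most \<open>(1 - \<delta>) ^ k\<close> each: from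
      \<open>push \<mu>\<close> to \<open>push (P k)\<close>, from there to \<open>P k\<close>, and
      from there to \<open>\<mu>\<close>.\<close>
    have "\<bar>measure (push \<mu>) B - measure \<mu> B\<bar> \<le> 3 * (1 - \<delta>) ^ k" for k
    proof -
      have "push (P k) = (push ^^ (n * k)) (push \<nu>)"
        by (simp add: P_def funpow_swap1)
      then have 1: "\<bar>measure (push (P k)) B - measure (P k) B\<bar> \<le> (1 - \<delta>) ^ k"
        using push_iter_close[OF prob_space_push[OF prob_\<nu> sets_\<nu>] sets_push prob_\<nu> sets_\<nu> B]
        by (simp add: P_def)
      have nn: "0 \<le> (1 - \<delta>) ^ k" using \<delta>_le_1 by simp
      \<comment> \<open>A one-sided comparison of two laws on all events survives one step, because
        \<open>push\<close> averages the masses of the preimages over the kicks. It is applied in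
        both directions below.\<close>
      have le: "emeasure (push \<mu>1) B \<le> emeasure (push \<mu>2) B + ennreal ((1 - \<delta>) ^ k)"
        if "prob_space \<mu>1" "sets \<mu>1 = sets circle" "prob_space \<mu>2" "sets \<mu>2 = sets circle"
          and le: "\<And>A. A \<in> sets circle \<Longrightarrow> measure \<mu>1 A \<le> measure \<mu>2 A + (1 - \<delta>) ^ k"
        for \<mu>1 \<mu>2 :: "real measure"
      proof -
        interpret M1: prob_space \<mu>1 by fact
        interpret M2: prob_space \<mu>2 by fact
        have [measurable_cong]: "sets \<mu>2 = sets circle" by fact
        have m: "(\<lambda>\<omega>. emeasure \<mu>2 (T \<omega> -` B \<inter> space circle)) \<in> borel_measurable \<eta>"
        proof -
          have sp: "space \<mu>2 = space circle" using that(4) sets_eq_imp_space_eq by blast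
          have "(\<lambda>\<omega>. emeasure \<mu>2 (Pair \<omega> -` ((\<lambda>(\<omega>, x). T \<omega> x) -` B \<inter> space (\<eta> \<Otimes>\<^sub>M \<mu>2)))) \<in> borel_measurable \<eta>"
            using T_measurable'[OF that(4)] B
            by (intro M2.measurable_emeasure_Pair) (rule measurable_sets)
          also have "?this \<longleftrightarrow> ?thesis"
            by (intro measurable_cong arg_cong[of _ _ "emeasure \<mu>2"]) (auto simp: space_pair_measure sp)
          finally show ?thesis .
        qed
        have "emeasure (push \<mu>1) B \<le>
            (\<integral>\<^sup>+ \<omega>. emeasure \<mu>2 (T \<omega> -` B \<inter> space circle) + ennreal ((1 - \<delta>) ^ k) \<partial>\<eta>)"
          unfolding emeasure_push[OF that(1,2) B]
        proof (rule nn_integral_mono)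
          fix \<omega> assume "\<omega> \<in> space \<eta>"
          then have "T \<omega> -` B \<inter> space circle \<in> sets circle"
            using T_sections' B by (blast intro: measurable_sets)
          from le[OF this] show "emeasure \<mu>1 (T \<omega> -` B \<inter> space circle) \<le>
              emeasure \<mu>2 (T \<omega> -` B \<inter> space circle) + ennreal ((1 - \<delta>) ^ k)"
            using nn by (simp add: M1.emeasure_eq_measure M2.emeasure_eq_measure flip: ennreal_plus)
        qed
        also have "\<dots> = emeasure (push \<mu>2) B + ennreal ((1 - \<delta>) ^ k)"
          unfolding emeasure_push[OF that(3,4) B]
          using m by (simp add: nn_integral_add emeasure_space_1)
        finally show ?thesis .
      qed
      have close: "\<bar>measure \<mu> A - measure (P k) A\<bar> \<le> (1 - \<delta>) ^ k" if "A \<in> sets circle" for A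
        using m[OF that, of k] \<mu>_eq[OF that] by simp
      have "emeasure (push \<mu>) B \<le> emeasure (push (P k)) B + ennreal ((1 - \<delta>) ^ k)"
      proof (rule le[OF \<mu> P])
        show "measure \<mu> A \<le> measure (P k) A + (1 - \<delta>) ^ k" if "A \<in> sets circle" for A
          using close[OF that] by linarith
      qed
      moreover have "emeasure (push (P k)) B \<le> emeasure (push \<mu>) B + ennreal ((1 - \<delta>) ^ k)"
      proof (rule le[OF P \<mu>])
        show "measure (P k) A \<le> measure \<mu> A + (1 - \<delta>) ^ k" if "A \<in> sets circle" for A
          using close[OF that] by linarith
      qed
      ultimately have 2: "\<bar>measure (push \<mu>) B - measure (push (P k)) B\<bar> \<le> (1 - \<delta>) ^ k"
        using nn by (simp add: p\<mu>.emeasure_eq_measure Q.emeasure_eq_measure flip: ennreal_plus)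
      show ?thesis using 1 2 close[OF B] by linarith
    qed
    then have "\<bar>measure (push \<mu>) B - measure \<mu> B\<bar> \<le> 3 * 0"
      by (intro LIMSEQ_le_const[OF tendsto_mult_left[OF contraction_tendsto]]) blast
    then show "emeasure (push \<mu>) B = emeasure \<mu> B"
      by (simp add: p\<mu>.emeasure_eq_measure \<mu>.emeasure_eq_measure)
  qed (simp add: \<mu>)
  then show ?thesis using \<mu> by (auto simp: invariant_iff_push)
qed

end

text \<open>If \<open>B\<close> is invariant, then conditioning \<^term>\<open>\<mu>\<close> on \<open>B\<close> gives an invariant measure
  again, which is \<^term>\<open>\<mu>\<close> itself by uniqueness.\<close>
lemma (in random_circle_map) invariant_imp_ergodic:
  assumes inv: "invariant_measure \<eta> T \<mu>"
    and unique: "\<And>\<mu>'. invariant_measure \<eta> T \<mu>' \<Longrightarrow> \<mu>' = \<mu>"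
  shows "ergodic_invariant_measure \<eta> T \<mu>"
  unfolding ergodic_invariant_measure_def
proof (intro conjI ballI impI)
  have \<mu>: "prob_space \<mu>" and sets_\<mu>: "sets \<mu> = sets circle"
    and inv': "\<And>B. B \<in> sets circle \<Longrightarrow>
       emeasure \<mu> B = (\<integral>\<^sup>+ \<omega>. emeasure \<mu> (T \<omega> -` B \<inter> space circle) \<partial>\<eta>)"
    using inv by (auto simp: invariant_measure_def)
  interpret \<mu>: prob_space \<mu> by fact
  fix B assume B: "B \<in> sets circle"
    and AE: "AE \<omega> in \<eta>. measure \<mu> (sym_diff B (T \<omega> -` B \<inter> space circle)) = 0"
  show "measure \<mu> B \<in> {0, 1}"
  proof (cases "measure \<mu> B = 0")
    case False
    then have pos: "emeasure \<mu> B \<noteq> 0" by (simp add: \<mu>.emeasure_eq_measure)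
    define \<mu>' where "\<mu>' = uniform_measure \<mu> B"
    have "prob_space \<mu>'" unfolding \<mu>'_def
      by (rule prob_space_uniform_measure) (use pos in auto)
    \<comment> \<open>Invariance is applied to \<open>B \<inter> A\<close>; for almost every kick
      the preimage of \<open>B\<close> may be replaced by \<open>B\<close> up to a null set. Thus
      the restriction of \<open>\<mu>\<close> to \<open>B\<close> is preserved as well.\<close>
    have *: "emeasure \<mu> (B \<inter> A) = (\<integral>\<^sup>+ \<omega>. emeasure \<mu> (B \<inter> (T \<omega> -` A \<inter> space circle)) \<partial>\<eta>)"
      if A: "A \<in> sets circle" for A
    proof -
      have "emeasure \<mu> (B \<inter> A) = (\<integral>\<^sup>+ \<omega>. emeasure \<mu> (T \<omega> -` (B \<inter> A) \<inter> space circle) \<partial>\<eta>)"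
        using A B by (intro inv') auto
      also have "\<dots> = (\<integral>\<^sup>+ \<omega>. emeasure \<mu> (B \<inter> (T \<omega> -` A \<inter> space circle)) \<partial>\<eta>)"
      proof (rule nn_integral_cong_AE, use AE AE_space in eventually_elim)
        case (elim \<omega>)
        have m: "T \<omega> -` S \<inter> space circle \<in> sets \<mu>" if "S \<in> sets circle" for S
          using measurable_sets[OF T_sections'[OF elim(2)] that] sets_\<mu> by simp
        have "sym_diff B (T \<omega> -` B \<inter> space circle) \<in> null_sets \<mu>"
          using elim(1) B m[OF B] sets_\<mu> by (auto simp: \<mu>.emeasure_eq_measure)
        then have "AE x in \<mu>. x \<notin> sym_diff B (T \<omega> -` B \<inter> space circle)"
          by (rule AE_not_in)
        then have "AE x in \<mu>. x \<in> T \<omega> -` (B \<inter> A) \<inter> space circle \<longleftrightarrow>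
            x \<in> B \<inter> (T \<omega> -` A \<inter> space circle)"
          by (rule eventually_mono) auto
        then show ?case
          by (rule emeasure_eq_AE) (use m[OF A] m[of "B \<inter> A"] B A sets_\<mu> in auto)
      qed
      finally show ?thesis .
    qed
    have "invariant_measure \<eta> T \<mu>'"
      unfolding invariant_measure_def
    proof (intro conjI ballI)
      show "prob_space \<mu>'" by fact
      show "sets \<mu>' = sets circle" by (simp add: \<mu>'_def sets_\<mu>)
      fix A assume A: "A \<in> sets circle"
      have m: "T \<omega> -` A \<inter> space circle \<in> sets \<mu>" if "\<omega> \<in> space \<eta>" for \<omega>
        using measurable_sets[OF T_sections'[OF that] A] sets_\<mu> by simp
      have [measurable_cong]: "sets \<mu> = sets circle" by fact
      have "emeasure \<mu>' A = emeasure \<mu> (B \<inter> A) / emeasure \<mu> B"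
        using A B sets_\<mu> by (simp add: \<mu>'_def)
      also have "\<dots> = (\<integral>\<^sup>+ \<omega>. emeasure \<mu> (B \<inter> (T \<omega> -` A \<inter> space circle)) / emeasure \<mu> B \<partial>\<eta>)"
      proof -
        have sp: "space \<mu> = space circle" using sets_\<mu> sets_eq_imp_space_eq by blast
        \<comment> \<open>Writing the integrand as the mass of a section of a product-measurable set
          shows its measurability in the kick, so that division by \<open>emeasure \<mu> B\<close>
          passes through the integral.\<close>
        let ?X = "((\<lambda>(\<omega>, x). T \<omega> x) -` A \<inter> space (\<eta> \<Otimes>\<^sub>M \<mu>)) \<inter> (space \<eta> \<times> B)"
        have "?X \<in> sets (\<eta> \<Otimes>\<^sub>M \<mu>)"
          using T_measurable'[OF sets_\<mu>] A B sets_\<mu> by (intro sets.Int measurable_sets pair_measureI) auto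
        then have "(\<lambda>\<omega>. emeasure \<mu> (Pair \<omega> -` ?X)) \<in> borel_measurable \<eta>"
          by (rule \<mu>.measurable_emeasure_Pair)
        also have "?this \<longleftrightarrow> (\<lambda>\<omega>. emeasure \<mu> (B \<inter> (T \<omega> -` A \<inter> space circle))) \<in> borel_measurable \<eta>"
          by (intro measurable_cong arg_cong[of _ _ "emeasure \<mu>"]) (auto simp: space_pair_measure sp)
        finally show ?thesis
          by (simp add: *[OF A] nn_integral_divide)
      qed
      also have "\<dots> = (\<integral>\<^sup>+ \<omega>. emeasure \<mu>' (T \<omega> -` A \<inter> space circle) \<partial>\<eta>)"
        using m B sets_\<mu> by (intro nn_integral_cong) (simp add: \<mu>'_def)
      finally show "emeasure \<mu>' A = (\<integral>\<^sup>+ \<omega>. emeasure \<mu>' (T \<omega> -` A \<inter> space circle) \<partial>\<eta>)" .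
    qed
    then have "\<mu>' = \<mu>" by (rule unique)
    then have "measure \<mu> B = measure \<mu>' B" by simp
    also have "\<dots> = 1"
      using B sets_\<mu> False unfolding \<mu>'_def
      by (subst measure_uniform_measure) (use pos in auto)
    finally show ?thesis by simp
  qed simp
qed (fact inv)

lemma (in doeblin_circle_map) unique_ergodic_invariant:
  "\<exists>!\<mu>. ergodic_invariant_measure \<eta> T \<mu>"
proof -
  obtain \<mu> where \<mu>: "invariant_measure \<eta> T \<mu>" using invariant_exists by blast
  show ?thesis
  proof (rule ex1I)
    show "ergodic_invariant_measure \<eta> T \<mu>"
      by (rule invariant_imp_ergodic) (use \<mu> invariant_unique in auto)
  qed (use \<mu> invariant_unique in \<open>auto simp: ergodic_invariant_measure_def\<close>)
qed

section \<open>Minorization for a circle map with uniform noise\<close>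

lemma frac_measurable_circle [measurable]: "frac \<in> borel \<rightarrow>\<^sub>M circle"
proof -
  have "(frac :: real \<Rightarrow> real) \<in> borel_measurable borel"
    unfolding frac_def[abs_def] by measurable
  then show ?thesis
    unfolding circle_def by (intro measurable_restrict_space2) (auto simp: frac_lt_1)
qed

definition circle_lebesgue :: "real measure" where
  "circle_lebesgue = restrict_space lborel {0..<1}"

lemma sets_circle_lebesgue [measurable_cong]: "sets circle_lebesgue = sets circle"
  by (simp add: circle_lebesgue_def circle_def sets_restrict_space)

lemma nn_integral_circle_lebesgue:
  "(\<integral>\<^sup>+ x. f x \<partial>circle_lebesgue) = (\<integral>\<^sup>+ x. f x * indicator {0..<1} x \<partial>lborel)"
  unfolding circle_lebesgue_def by (rule nn_integral_restrict_space) simp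

lemma prob_space_circle_lebesgue: "prob_space circle_lebesgue"
proof (rule prob_spaceI)
  have "emeasure circle_lebesgue {0..<1} = emeasure lborel {0..<1::real}"
    unfolding circle_lebesgue_def by (rule emeasure_restrict_space) auto
  then show "emeasure circle_lebesgue (space circle_lebesgue) = 1"
    by (simp add: circle_lebesgue_def space_restrict_space)
qed

text \<open>The window contains exactly one integer \<open>k\<close>. Cutting there and translating
  the left piece by \<open>k - 1\<close> and the right piece by \<open>k\<close> tiles
  [0,1).\<close>

lemma nn_integral_frac_period:
  assumes [measurable]: "f \<in> borel_measurable circle"
  shows "(\<integral>\<^sup>+ x. f (frac x) * indicator {u..<u+1} x \<partial>lborel) = (\<integral>\<^sup>+ x. f x \<partial>circle_lebesgue)"
proof -
  define k where "k = \<lceil>u\<rceil>"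
  have k: "of_int k - 1 < u" "u \<le> of_int k" unfolding k_def by linarith+
  have [simp]: "frac (of_int j + x) = frac x" "frac (of_int j - 1 + x) = frac x" for j and x :: real
  proof -
    show "frac (of_int j + x) = frac x" for j and x :: real by (simp add: frac_def)
    from this[of "j - 1"] show "frac (of_int j - 1 + x) = frac x" by simp
  qed
  have "(\<integral>\<^sup>+ x. f (frac x) * indicator {u..<u+1} x \<partial>lborel) =
      (\<integral>\<^sup>+ x. f (frac x) * indicator {u..<of_int k} x + f (frac x) * indicator {of_int k..<u+1} x \<partial>lborel)"
    using k by (intro nn_integral_cong) (auto simp: indicator_def)
  also have "\<dots> = (\<integral>\<^sup>+ x. f (frac x) * indicator {u..<of_int k} x \<partial>lborel) +
      (\<integral>\<^sup>+ x. f (frac x) * indicator {of_int k..<u+1} x \<partial>lborel)"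
    by (rule nn_integral_add) measurable
  also have "(\<integral>\<^sup>+ x. f (frac x) * indicator {u..<of_int k} x \<partial>lborel) =
      (\<integral>\<^sup>+ x. f (frac x) * indicator {u - of_int k + 1..<1} x \<partial>lborel)"
    by (subst nn_integral_real_affine[where c = 1 and t = "of_int k - 1"])
      (auto simp: indicator_def intro!: nn_integral_cong)
  also have "(\<integral>\<^sup>+ x. f (frac x) * indicator {of_int k..<u+1} x \<partial>lborel) =
      (\<integral>\<^sup>+ x. f (frac x) * indicator {0..<u - of_int k + 1} x \<partial>lborel)"
    by (subst nn_integral_real_affine[where c = 1 and t = "of_int k"])
      (auto simp: indicator_def intro!: nn_integral_cong)
  also have "(\<integral>\<^sup>+ x. f (frac x) * indicator {u - of_int k + 1..<1} x \<partial>lborel) + \<dots> =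
      (\<integral>\<^sup>+ x. f (frac x) * indicator {u - of_int k + 1..<1} x +
        f (frac x) * indicator {0..<u - of_int k + 1} x \<partial>lborel)"
    by (rule nn_integral_add[symmetric]) measurable
  also have "\<dots> = (\<integral>\<^sup>+ x. f x \<partial>circle_lebesgue)"
    unfolding nn_integral_circle_lebesgue
    using k by (intro nn_integral_cong) (auto simp: indicator_def frac_eq_id)
  finally show ?thesis .
qed

lemma nn_integral_frac_periods:
  assumes [measurable]: "f \<in> borel_measurable circle"
  shows "(\<integral>\<^sup>+ x. f (frac x) * indicator {u..<u + real N} x \<partial>lborel) =
    of_nat N * (\<integral>\<^sup>+ x. f x \<partial>circle_lebesgue)"
proof (induction N)
  case (Suc N)
  have "(\<integral>\<^sup>+ x. f (frac x) * indicator {u..<u + real (Suc N)} x \<partial>lborel) =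
      (\<integral>\<^sup>+ x. f (frac x) * indicator {u..<u + real N} x +
        f (frac x) * indicator {u + real N..<u + real N + 1} x \<partial>lborel)"
    by (intro nn_integral_cong) (auto simp: indicator_def)
  also have "\<dots> = (\<integral>\<^sup>+ x. f (frac x) * indicator {u..<u + real N} x \<partial>lborel) +
      (\<integral>\<^sup>+ x. f (frac x) * indicator {u + real N..<u + real N + 1} x \<partial>lborel)"
    by (rule nn_integral_add) measurable
  also have "\<dots> = of_nat (Suc N) * (\<integral>\<^sup>+ x. f x \<partial>circle_lebesgue)"
    unfolding Suc.IH nn_integral_frac_period[OF assms] by (simp add: distrib_right add.commute)
  finally show ?case .
qed simp

text \<open>The image of the branch is an interval of length at least \<open>r\<close> with lower
  end \<open>min (F p) (F q)\<close>, so the window on the left-hand side fits into its translate by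
  \<open>\<omega>\<close>. Substituting \<open>y = F x + \<omega>\<close> brings in the Jacobian,
  which is at most \<open>D\<close>.\<close>

lemma nn_integral_monotone_branch:
  fixes F F' :: "real \<Rightarrow> real" and h :: "real \<Rightarrow> ennreal"
  assumes h [measurable]: "h \<in> borel_measurable borel"
    and deriv: "\<And>x. (F has_real_derivative F' x) (at x)" and cont: "continuous_on UNIV F'"
    and "p < q" and bound: "\<And>x. x \<in> {p..q} \<Longrightarrow> \<bar>F' x\<bar> \<le> D"
    and sign: "(\<forall>x\<in>{p..q}. F' x \<ge> 0) \<or> (\<forall>x\<in>{p..q}. F' x \<le> 0)"
    and length: "\<bar>F q - F p\<bar> \<ge> r"
  shows "(\<integral>\<^sup>+ y. h y * indicator {min (F p) (F q) + \<omega>..min (F p) (F q) + \<omega> + r} y \<partial>lborel)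
    \<le> ennreal D * (\<integral>\<^sup>+ x. h (F x + \<omega>) * indicator {p..q} x \<partial>lborel)"
proof -
  have contF: "continuous_on UNIV F"
    using deriv by (auto intro!: continuous_at_imp_continuous_on DERIV_isCont)
  then have [measurable]: "F \<in> borel_measurable borel"
    by (rule borel_measurable_continuous_onI)
  have D: "ennreal \<bar>F' x\<bar> \<le> ennreal D" if "x \<in> {p..q}" for x
    using bound[OF that] by (rule ennreal_leI)
  have upper: "(\<integral>\<^sup>+ x. h (F x + \<omega>) * ennreal \<bar>F' x\<bar> * indicator {p..q} x \<partial>lborel) \<le>
      ennreal D * (\<integral>\<^sup>+ x. h (F x + \<omega>) * indicator {p..q} x \<partial>lborel)"
    by (subst nn_integral_cmult[symmetric], measurable, rule nn_integral_mono)
      (use D in \<open>auto simp: indicator_def mult.commute intro!: mult_right_mono\<close>)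
  from sign show ?thesis
  proof
    assume pos: "\<forall>x\<in>{p..q}. F' x \<ge> 0"
    have "F p \<le> F q"
      using \<open>p < q\<close> pos deriv
      by (intro DERIV_nonneg_imp_nondecreasing[where f = F]) (simp, meson atLeastAtMost_iff)
    then have "(\<integral>\<^sup>+ y. h y * indicator {min (F p) (F q) + \<omega>..min (F p) (F q) + \<omega> + r} y \<partial>lborel) \<le>
        (\<integral>\<^sup>+ y. h y * indicator {F p + \<omega>..F q + \<omega>} y \<partial>lborel)"
      using length by (intro nn_integral_mono mult_left_mono) (auto simp: indicator_def)
    also have "\<dots> = (\<integral>\<^sup>+ x. h (F x + \<omega>) * ennreal (F' x) * indicator {p..q} x \<partial>lborel)"
      by (rule nn_integral_substitution_aux)
        (use pos deriv \<open>p < q\<close> in \<open>auto intro!: derivative_eq_intros continuous_on_subset[OF cont]\<close>)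
    also have "\<dots> = (\<integral>\<^sup>+ x. h (F x + \<omega>) * ennreal \<bar>F' x\<bar> * indicator {p..q} x \<partial>lborel)"
      by (intro nn_integral_cong) (use pos in \<open>auto simp: indicator_def\<close>)
    finally show ?thesis using upper by (rule order_trans)
  next
    assume neg: "\<forall>x\<in>{p..q}. F' x \<le> 0"
    have "F q \<le> F p"
      using \<open>p < q\<close> neg deriv
      by (intro DERIV_nonpos_imp_nonincreasing[where f = F]) (simp, meson atLeastAtMost_iff)
    then have "(\<integral>\<^sup>+ y. h y * indicator {min (F p) (F q) + \<omega>..min (F p) (F q) + \<omega> + r} y \<partial>lborel) \<le>
        (\<integral>\<^sup>+ y. h y * indicator {F q + \<omega>..F p + \<omega>} y \<partial>lborel)"
      using length by (intro nn_integral_mono mult_left_mono) (auto simp: indicator_def)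
    \<comment> \<open>The reflection \<open>y \<mapsto> - y\<close> turns the decreasing branch into
      an increasing one, to which the substitution rule applies.\<close>
    also have "\<dots> = (\<integral>\<^sup>+ y. h (- y) * indicator {- (F p + \<omega>)..- (F q + \<omega>)} y \<partial>lborel)"
      by (subst nn_integral_real_affine[where c = "-1" and t = 0])
        (auto simp: indicator_def intro!: nn_integral_cong)
    also have "\<dots> = (\<integral>\<^sup>+ x. h (- (- (F x + \<omega>))) * ennreal (- F' x) * indicator {p..q} x \<partial>lborel)"
      by (rule nn_integral_substitution_aux[where f = "\<lambda>y. h (- y)" and g = "\<lambda>x. - (F x + \<omega>)"])
        (use neg deriv \<open>p < q\<close> in \<open>auto intro!: derivative_eq_intros continuous_intros continuous_on_subset[OF cont]\<close>)
    also have "\<dots> = (\<integral>\<^sup>+ x. h (F x + \<omega>) * ennreal \<bar>F' x\<bar> * indicator {p..q} x \<partial>lborel)"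
      by (intro nn_integral_cong) (use neg in \<open>auto simp: indicator_def add.commute\<close>)
    finally show ?thesis using upper by (rule order_trans)
  qed
qed

lemma deriv_periodic:
  fixes f :: "real \<Rightarrow> real"
  assumes "\<And>x. f (x + 1) = f x" and "\<And>x. f differentiable at x"
  shows "deriv f (x + 1) = deriv f x"
proof -
  have "(f has_real_derivative deriv f (x + 1)) (at (x + 1))"
    using assms(2) by (simp add: DERIV_deriv_iff_real_differentiable)
  then have "(f has_real_derivative deriv f (x + 1)) (at x)"
    using assms(1) by (simp add: DERIV_shift)
  then show ?thesis by (simp add: DERIV_imp_deriv)
qed

lemma periodic_int:
  fixes f :: "real \<Rightarrow> real"
  assumes "\<And>x. f (x + 1) = f x"
  shows "f (x + of_int k) = f x"
proof -
  have nat: "f (y + of_nat n) = f y" for y n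
    by (induction n) (use assms in \<open>auto simp: add.assoc[symmetric] add.commute[of 1]\<close>)
  show ?thesis
    using nat[of x "nat k"] nat[of "x + of_int k" "nat (- k)"] by (cases "k \<ge> 0") auto
qed

section \<open>The noisy circle map: density bound and spreading of arcs\<close>

locale noisy_circle_map =
  fixes \<psi> :: "real \<Rightarrow> real" and L a \<epsilon> :: real
  assumes C2: "C2_circle_function \<psi>" and \<epsilon>_pos: "\<epsilon> > 0"
begin

lemma deriv_\<psi>: "(\<psi> has_real_derivative deriv \<psi> x) (at x)"
  using C2 by (simp add: C2_circle_function_def DERIV_deriv_iff_real_differentiable)

lemma cont_\<psi>: "continuous_on UNIV \<psi>"
  using deriv_\<psi> by (auto intro!: continuous_at_imp_continuous_on DERIV_isCont)

lemma cont_deriv_\<psi>: "continuous_on UNIV (deriv \<psi>)"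
  using C2 by (auto simp: C2_circle_function_def intro!: continuous_at_imp_continuous_on differentiable_imp_continuous_within)

lemma \<psi>_measurable [measurable]: "\<psi> \<in> borel_measurable borel"
  by (rule borel_measurable_continuous_onI[OF cont_\<psi>])

lemma \<psi>_frac: "\<psi> (frac x) = \<psi> x"
  using periodic_int[of \<psi> "frac x" "\<lfloor>x\<rfloor>"] C2 by (simp add: frac_def C2_circle_function_def)

lemma tau_deriv_bounded: "\<exists>D. \<forall>x. \<bar>tau_deriv \<psi> L x\<bar> \<le> D"
proof -
  have cont: "continuous_on {0..1} (\<lambda>x. \<bar>tau_deriv \<psi> L x\<bar>)"
    unfolding tau_deriv_def[abs_def]
    by (intro continuous_intros continuous_on_subset[OF cont_deriv_\<psi>]) auto
  obtain z where z: "\<And>x. x \<in> {0..1} \<Longrightarrow> \<bar>tau_deriv \<psi> L x\<bar> \<le> \<bar>tau_deriv \<psi> L z\<bar>"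
    using continuous_attains_sup[OF _ _ cont] by (metis atLeastAtMost_iff compact_Icc empty_iff order_refl zero_le_one)
  have "deriv \<psi> (x + 1) = deriv \<psi> x" for x
    using C2 by (intro deriv_periodic) (auto simp: C2_circle_function_def)
  then have "deriv \<psi> (frac x) = deriv \<psi> x" for x
    using periodic_int[of "deriv \<psi>" "frac x" "\<lfloor>x\<rfloor>"] by (simp add: frac_def)
  then have "tau_deriv \<psi> L (frac x) = tau_deriv \<psi> L x" for x by (simp add: tau_deriv_def)
  then have "\<bar>tau_deriv \<psi> L x\<bar> \<le> \<bar>tau_deriv \<psi> L z\<bar>" for x
    using z[of "frac x"] by (simp add: frac_lt_1 less_imp_le)
  then show ?thesis by blast
qed

abbreviation T where "T \<equiv> tau_kicked \<psi> L a"

definition lift :: "real \<Rightarrow> real" where "lift x = a + x + L * \<psi> x"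

lemma T_eq: "T \<omega> x = frac (lift x + \<omega>)"
  by (simp add: tau_kicked_def tau_def lift_def)

lemma T_frac: "T \<omega> (frac x) = T \<omega> x"
proof -
  have "lift (frac x) + \<omega> = frac x + (a + L * \<psi> x + \<omega>)" "lift x + \<omega> = x + (a + L * \<psi> x + \<omega>)"
    by (simp_all add: lift_def \<psi>_frac)
  then show ?thesis by (simp only: T_eq frac_add_simps)
qed

lemma lift_measurable [measurable]: "lift \<in> borel_measurable borel"
  unfolding lift_def[abs_def] by measurable

lemma deriv_lift: "(lift has_real_derivative tau_deriv \<psi> L x) (at x)"
  unfolding lift_def[abs_def] tau_deriv_def by (auto intro!: derivative_eq_intros deriv_\<psi>)

lemma cont_tau_deriv: "continuous_on UNIV (tau_deriv \<psi> L)"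
  unfolding tau_deriv_def[abs_def] by (intro continuous_intros cont_deriv_\<psi>)

lemma sets_noise [measurable_cong, simp]: "sets (noise \<epsilon>) = sets borel"
  by (simp add: noise_def)

sublocale random_circle_map "noise \<epsilon>" T
proof (rule random_circle_map.intro)
  show "prob_space (noise \<epsilon>)"
    unfolding noise_def by (rule prob_space_uniform_measure) (use \<epsilon>_pos in auto)
  have "(\<lambda>(\<omega>, x). frac (lift x + \<omega>)) \<in> borel \<Otimes>\<^sub>M circle \<rightarrow>\<^sub>M circle"
  proof -
    have [measurable]: "lift \<in> borel_measurable circle"
      unfolding circle_def by (rule measurable_restrict_space1) measurable
    show ?thesis by measurable
  qed
  then show "random_circle_map_axioms (noise \<epsilon>) T"
    unfolding random_circle_map_axioms_def T_eq[abs_def] by measurable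
qed

text \<open>The kick smooths: one step from \<open>x\<close> averages over a window of length
  \<open>2 * \<epsilon>\<close> around \<open>lift x\<close>. Both the density bound and the
  minorization are read off from this form.\<close>

lemma transfer_eq:
  assumes [measurable]: "f \<in> borel_measurable circle"
  shows "transfer f x = (\<integral>\<^sup>+ y. f (frac y) * indicator {lift x - \<epsilon>..lift x + \<epsilon>} y \<partial>lborel) / ennreal (2 * \<epsilon>)"
proof -
  have "transfer f x =
      (\<integral>\<^sup>+ \<omega>. f (frac (lift x + \<omega>)) * indicator {-\<epsilon>..\<epsilon>} \<omega> \<partial>lborel) / emeasure lborel {-\<epsilon>..\<epsilon>}"
    unfolding transfer_def unfolding T_eq noise_def by (rule nn_integral_uniform_measure) auto
  also have "(\<integral>\<^sup>+ \<omega>. f (frac (lift x + \<omega>)) * indicator {-\<epsilon>..\<epsilon>} \<omega> \<partial>lborel) =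
      (\<integral>\<^sup>+ y. f (frac y) * indicator {lift x - \<epsilon>..lift x + \<epsilon>} y \<partial>lborel)"
    by (subst (2) nn_integral_real_affine[where c = 1 and t = "lift x"])
      (auto simp: indicator_def intro!: nn_integral_cong)
  finally show ?thesis using \<epsilon>_pos by simp
qed

text \<open>The window of length \<open>2 * \<epsilon>\<close> is covered by \<open>N\<close> full
  periods, and \<open>N / (2 * \<epsilon>)\<close> is at most
  \<open>1 + 1 / (2 * \<epsilon>)\<close>. The strict bound \<open>N > 2 * \<epsilon>\<close> places
  the closed window inside the half-open union of periods.\<close>

lemma transfer_le:
  assumes f [measurable]: "f \<in> borel_measurable circle"
  shows "transfer f x \<le> ennreal (1 + 1 / (2 * \<epsilon>)) * (\<integral>\<^sup>+ y. f y \<partial>circle_lebesgue)"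
proof -
  define N where "N = nat \<lfloor>2 * \<epsilon>\<rfloor> + 1"
  have N: "real N > 2 * \<epsilon>" "real N \<le> 2 * \<epsilon> + 1"
    using \<epsilon>_pos unfolding N_def by linarith+
  have "(\<integral>\<^sup>+ y. f (frac y) * indicator {lift x - \<epsilon>..lift x + \<epsilon>} y \<partial>lborel) \<le>
      (\<integral>\<^sup>+ y. f (frac y) * indicator {lift x - \<epsilon>..<lift x - \<epsilon> + real N} y \<partial>lborel)"
    using N by (intro nn_integral_mono mult_left_mono) (auto simp: indicator_def)
  also have "\<dots> = ennreal (real N) * (\<integral>\<^sup>+ y. f y \<partial>circle_lebesgue)"
    by (simp add: nn_integral_frac_periods ennreal_of_nat_eq_real_of_nat)
  finally have "transfer f x \<le> (ennreal (real N) * (\<integral>\<^sup>+ y. f y \<partial>circle_lebesgue)) / ennreal (2 * \<epsilon>)"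
    by (simp add: transfer_eq divide_right_mono_ennreal)
  also have "\<dots> = ennreal (real N / (2 * \<epsilon>)) * (\<integral>\<^sup>+ y. f y \<partial>circle_lebesgue)"
    using \<epsilon>_pos by (simp add: divide_ennreal[symmetric] ennreal_divide_times mult.commute ennreal_times_divide)
  also have "\<dots> \<le> ennreal (1 + 1 / (2 * \<epsilon>)) * (\<integral>\<^sup>+ y. f y \<partial>circle_lebesgue)"
    using N \<epsilon>_pos by (intro mult_right_mono ennreal_leI) (auto simp: field_simps)
  finally show ?thesis .
qed

text \<open>Integrated form of a density bound: an invariant law equals its own image after one
  step, and every transition law already has a density of this size.\<close>

lemma invariant_density_bound:
  assumes inv: "invariant_measure (noise \<epsilon>) T \<mu>" and f: "f \<in> borel_measurable circle"
  shows "(\<integral>\<^sup>+ x. f x \<partial>\<mu>) \<le> ennreal (1 + 1 / (2 * \<epsilon>)) * (\<integral>\<^sup>+ y. f y \<partial>circle_lebesgue)"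
proof -
  have \<mu>: "prob_space \<mu>" "sets \<mu> = sets circle" "push \<mu> = \<mu>"
    using inv by (auto simp: invariant_iff_push)
  have "(\<integral>\<^sup>+ x. f x \<partial>\<mu>) = (\<integral>\<^sup>+ x. transfer f x \<partial>\<mu>)"
    using nn_integral_push[OF \<mu>(1,2) f] \<mu>(3) by simp
  also have "\<dots> \<le> (\<integral>\<^sup>+ x. ennreal (1 + 1 / (2 * \<epsilon>)) * (\<integral>\<^sup>+ y. f y \<partial>circle_lebesgue) \<partial>\<mu>)"
    by (intro nn_integral_mono transfer_le f)
  finally show ?thesis using prob_space.emeasure_space_1[OF \<mu>(1)] by simp
qed

text \<open>The minorization is propagated in integrated form, over arcs of the starting point. Under this
  form a kick merely translates the image of an arc, so no convolution has to be bounded below.\<close>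
definition spreads :: "real \<Rightarrow> bool" where
  "spreads l \<longleftrightarrow> (\<exists>n \<delta>. \<delta> > 0 \<and> (\<forall>f\<in>borel_measurable circle. \<forall>u.
     ennreal \<delta> * (\<integral>\<^sup>+ x. f x \<partial>circle_lebesgue)
       \<le> (\<integral>\<^sup>+ x. (transfer ^^ n) f (frac x) * indicator {u..u + l} x \<partial>lborel)))"

lemma spreads_1: "spreads 1"
  unfolding spreads_def
proof (rule exI[of _ 0], rule exI[of _ 1], safe)
  fix f :: "real \<Rightarrow> ennreal" and u :: real
  assume f: "f \<in> borel_measurable circle"
  have "(\<integral>\<^sup>+ x. f x \<partial>circle_lebesgue) = (\<integral>\<^sup>+ x. f (frac x) * indicator {u..<u + 1} x \<partial>lborel)"
    by (rule nn_integral_frac_period[OF f, symmetric])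
  also have "\<dots> \<le> (\<integral>\<^sup>+ x. f (frac x) * indicator {u..u + 1} x \<partial>lborel)"
    by (intro nn_integral_mono mult_left_mono) (auto simp: indicator_def)
  finally show "ennreal 1 * (\<integral>\<^sup>+ x. f x \<partial>circle_lebesgue)
      \<le> (\<integral>\<^sup>+ x. (transfer ^^ 0) f (frac x) * indicator {u..u + 1} x \<partial>lborel)" by simp
qed simp

lemma spreads_mono:
  assumes "spreads l" "l \<le> l'"
  shows "spreads l'"
proof -
  have "(\<integral>\<^sup>+ x. (transfer ^^ n) f (frac x) * indicator {u..u + l} x \<partial>lborel)
      \<le> (\<integral>\<^sup>+ x. (transfer ^^ n) f (frac x) * indicator {u..u + l'} x \<partial>lborel)" for n f u
    using assms(2) by (intro nn_integral_mono mult_left_mono) (auto simp: indicator_def)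
  then show ?thesis
    using assms(1) unfolding spreads_def by (meson order_trans)
qed

text \<open>For every fixed kick the branch is mapped over an arc of length \<open>2 * l\<close>, to
  which the hypothesis applies; the change of variables costs a factor depending on
  \<open>D\<close>. Averaging over the kick and exchanging the integrals produces one more
  \<open>transfer\<close> step.\<close>

lemma spreads_half:
  assumes sp: "spreads (2 * l)"
    and branch: "\<And>u. \<exists>p q. u \<le> p \<and> p < q \<and> q \<le> u + l \<and> \<bar>lift q - lift p\<bar> \<ge> 2 * l \<and>
      ((\<forall>x\<in>{p..q}. tau_deriv \<psi> L x \<ge> 0) \<or> (\<forall>x\<in>{p..q}. tau_deriv \<psi> L x \<le> 0))"
    and D: "\<And>x. \<bar>tau_deriv \<psi> L x\<bar> \<le> D"
  shows "spreads l"
proof -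
  obtain n \<delta> where \<delta>: "\<delta> > 0" and sp: "\<And>f u. f \<in> borel_measurable circle \<Longrightarrow>
      ennreal \<delta> * (\<integral>\<^sup>+ x. f x \<partial>circle_lebesgue)
       \<le> (\<integral>\<^sup>+ x. (transfer ^^ n) f (frac x) * indicator {u..u + 2 * l} x \<partial>lborel)"
    using sp unfolding spreads_def by blast
  \<comment> \<open>\<open>D + 1\<close> replaces \<open>D\<close> as Jacobian bound because it
    becomes a divisor and the assumption only forces \<open>D\<close> to be nonnegative.\<close>
  have D0: "D + 1 > 0" using D[of 0] by linarith
  show ?thesis unfolding spreads_def
  proof (rule exI[of _ "Suc n"], rule exI[of _ "\<delta> / (D + 1)"], safe)
    show "\<delta> / (D + 1) > 0" using \<delta> D0 by simp
    fix f :: "real \<Rightarrow> ennreal" and u :: real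
    assume f [measurable]: "f \<in> borel_measurable circle"
    define g where "g = (transfer ^^ n) f"
    have g [measurable]: "g \<in> borel_measurable circle" unfolding g_def by measurable
    let ?I = "\<integral>\<^sup>+ x. f x \<partial>circle_lebesgue"
    obtain p q where pq: "u \<le> p" "p < q" "q \<le> u + l" "\<bar>lift q - lift p\<bar> \<ge> 2 * l"
      "(\<forall>x\<in>{p..q}. tau_deriv \<psi> L x \<ge> 0) \<or> (\<forall>x\<in>{p..q}. tau_deriv \<psi> L x \<le> 0)"
      using branch[of u] by blast
    have le: "ennreal (\<delta> / (D + 1)) * ?I \<le>
        (\<integral>\<^sup>+ x. g (frac (lift x + \<omega>)) * indicator {u..u + l} x \<partial>lborel)" for \<omega>
    proof -
      define m where "m = min (lift p) (lift q) + \<omega>"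
      have "ennreal \<delta> * ?I \<le> (\<integral>\<^sup>+ y. g (frac y) * indicator {m..m + 2 * l} y \<partial>lborel)"
        unfolding g_def by (rule sp[OF f])
      also have "\<dots> \<le> ennreal (D + 1) * (\<integral>\<^sup>+ x. g (frac (lift x + \<omega>)) * indicator {p..q} x \<partial>lborel)"
        unfolding m_def
        by (rule nn_integral_monotone_branch[where h = "\<lambda>y. g (frac y)", OF _ deriv_lift cont_tau_deriv pq(2) _ pq(5,4)])
          (use D in \<open>auto intro: order_trans[OF D]\<close>)
      also have "\<dots> \<le> ennreal (D + 1) * (\<integral>\<^sup>+ x. g (frac (lift x + \<omega>)) * indicator {u..u + l} x \<partial>lborel)"
        using pq by (intro nn_integral_mono mult_left_mono) (auto simp: indicator_def)
      finally have "ennreal (1 / (D + 1)) * (ennreal \<delta> * ?I) \<le> ennreal (1 / (D + 1)) *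
          (ennreal (D + 1) * (\<integral>\<^sup>+ x. g (frac (lift x + \<omega>)) * indicator {u..u + l} x \<partial>lborel))"
        by (rule mult_left_mono) simp
      then show ?thesis
        using D0 \<delta> by (simp add: mult.assoc[symmetric] ennreal_mult'[symmetric])
    qed
    interpret pair_sigma_finite lborel "noise \<epsilon>" ..
    have "ennreal (\<delta> / (D + 1)) * ?I = (\<integral>\<^sup>+ \<omega>. ennreal (\<delta> / (D + 1)) * ?I \<partial>noise \<epsilon>)"
      using emeasure_space_1 by simp
    also have "\<dots> \<le> (\<integral>\<^sup>+ \<omega>. \<integral>\<^sup>+ x. g (frac (lift x + \<omega>)) * indicator {u..u + l} x \<partial>lborel \<partial>noise \<epsilon>)"
      by (intro nn_integral_mono le)
    also have "\<dots> = (\<integral>\<^sup>+ x. \<integral>\<^sup>+ \<omega>. g (frac (lift x + \<omega>)) * indicator {u..u + l} x \<partial>noise \<epsilon> \<partial>lborel)"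
      by (rule Fubini') measurable
    also have "\<dots> = (\<integral>\<^sup>+ x. (transfer ^^ Suc n) f (frac x) * indicator {u..u + l} x \<partial>lborel)"
      by (auto simp: g_def[symmetric] transfer_def[of g] T_frac T_eq[symmetric] indicator_def intro!: nn_integral_cong)
    finally show "ennreal (\<delta> / (D + 1)) * ?I \<le>
        (\<integral>\<^sup>+ x. (transfer ^^ Suc n) f (frac x) * indicator {u..u + l} x \<partial>lborel)" .
  qed
qed

text \<open>Arcs are halved from length 1 down to the scale of the noise. Since the first kick
  spreads a point over an arc of length \<open>2 * \<epsilon>\<close>, this yields a minorization by
  Lebesgue measure, uniform in the starting point.\<close>

lemma unique_ergodic:
  assumes branch: "\<And>u l. \<epsilon> < l \<Longrightarrow> l \<le> 1 \<Longrightarrow>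
      \<exists>p q. u \<le> p \<and> p < q \<and> q \<le> u + l \<and> \<bar>lift q - lift p\<bar> \<ge> 2 * l \<and>
      ((\<forall>x\<in>{p..q}. tau_deriv \<psi> L x \<ge> 0) \<or> (\<forall>x\<in>{p..q}. tau_deriv \<psi> L x \<le> 0))"
    and D: "\<And>x. \<bar>tau_deriv \<psi> L x\<bar> \<le> D"
  shows "\<exists>!\<mu>. ergodic_invariant_measure (noise \<epsilon>) T \<mu>"
proof -
  \<comment> \<open>Branches are available only for \<open>l > \<epsilon>\<close>; the maximum stops
    the descent there, because \<open>l \<le> \<epsilon>\<close> means that the previous length
    \<open>2 * l\<close> was already at most \<open>2 * \<epsilon>\<close>.\<close>
  have "spreads (max (2 * \<epsilon>) ((1 / 2) ^ k))" for k
  proof (induction k)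
    case 0
    show ?case by (rule spreads_mono[OF spreads_1]) simp
  next
    case (Suc k)
    define l :: real where "l = (1 / 2) ^ Suc k"
    have l: "(1 / 2) ^ k = 2 * l" by (simp add: l_def)
    have "l \<le> 1" unfolding l_def by (rule power_le_one) auto
    show ?case
    proof (cases "l \<le> \<epsilon>")
      case True
      then show ?thesis using Suc.IH l \<epsilon>_pos unfolding l_def[symmetric] by (simp add: max_def split: if_splits)
    next
      case False
      then have "spreads (2 * l)" using Suc.IH l by (simp add: max_def)
      then have "spreads l"
        by (rule spreads_half) (use False \<open>l \<le> 1\<close> branch D in auto)
      then show ?thesis unfolding l_def[symmetric] by (rule spreads_mono) simp
    qed
  qed
  moreover obtain k where "(1 / 2 :: real) ^ k < 2 * \<epsilon>"
    using real_arch_pow_inv[of "2 * \<epsilon>" "1 / 2"] \<epsilon>_pos by auto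
  ultimately have "spreads (2 * \<epsilon>)" by (metis less_eq_real_def max_absorb1)
  then obtain n \<delta> where \<delta>: "\<delta> > 0" and sp: "\<And>f u. f \<in> borel_measurable circle \<Longrightarrow>
      ennreal \<delta> * (\<integral>\<^sup>+ x. f x \<partial>circle_lebesgue)
       \<le> (\<integral>\<^sup>+ x. (transfer ^^ n) f (frac x) * indicator {u..u + 2 * \<epsilon>} x \<partial>lborel)"
    unfolding spreads_def by blast
  \<comment> \<open>The additional step and the factor \<open>1 / (2 * \<epsilon>)\<close> belong to
    the first kick.\<close>
  interpret doeblin_circle_map "noise \<epsilon>" T circle_lebesgue "Suc n" "\<delta> / (2 * \<epsilon>)"
  proof (intro doeblin_circle_map.intro doeblin_circle_map_axioms.intro)
    show "random_circle_map (noise \<epsilon>) T" by (rule random_circle_map_axioms)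
    show "prob_space circle_lebesgue" by (rule prob_space_circle_lebesgue)
    show "sets circle_lebesgue = sets circle" by (rule sets_circle_lebesgue)
    show "\<delta> / (2 * \<epsilon>) > 0" using \<delta> \<epsilon>_pos by simp
    fix f :: "real \<Rightarrow> ennreal" and x :: real assume f [measurable]: "f \<in> borel_measurable circle"
    have "ennreal (\<delta> / (2 * \<epsilon>)) * (\<integral>\<^sup>+ x. f x \<partial>circle_lebesgue) =
        (ennreal \<delta> * (\<integral>\<^sup>+ x. f x \<partial>circle_lebesgue)) / ennreal (2 * \<epsilon>)"
      using \<epsilon>_pos \<delta> by (simp add: divide_ennreal[symmetric] ennreal_times_divide mult.commute)
    also have "\<dots> \<le> transfer ((transfer ^^ n) f) x"
    proof -
      have "lift x - \<epsilon> + 2 * \<epsilon> = lift x + \<epsilon>" by simp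
      with sp[OF f, of "lift x - \<epsilon>"] show ?thesis
        unfolding transfer_eq[OF transfer_iter_measurable[OF f]]
        by (intro divide_right_mono_ennreal) (simp only:)
    qed
    finally show "ennreal (\<delta> / (2 * \<epsilon>)) * (\<integral>\<^sup>+ x. f x \<partial>circle_lebesgue) \<le> (transfer ^^ Suc n) f x"
      by simp
  qed
  show ?thesis by (rule unique_ergodic_invariant)
qed

end

section \<open>Nondegenerate critical points\<close>

text \<open>The sum of the absolute values of the first two derivatives is continuous, periodic and
  nowhere zero, so it has a positive minimum \<open>4 * m\<close>. At each point one of the
  derivatives is at least \<open>2 * m\<close> in absolute value, and uniform continuity loses less
  than \<open>m\<close> of it along an arc of length \<open>\<rho>\<close>.\<close>

lemma nondegenerate_uniform:
  assumes C2: "C2_circle_function \<psi>"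
    and crit: "\<forall>c\<in>critical_points \<psi>. deriv (deriv \<psi>) c \<noteq> 0"
  obtains m \<rho> :: real where "m > 0" "0 < \<rho>" "\<rho> \<le> 1"
    "\<And>u. (\<forall>x\<in>{u..u+\<rho>}. deriv \<psi> x \<ge> m) \<or> (\<forall>x\<in>{u..u+\<rho>}. deriv \<psi> x \<le> - m) \<or>
      (\<forall>x\<in>{u..u+\<rho>}. deriv (deriv \<psi>) x \<ge> m) \<or> (\<forall>x\<in>{u..u+\<rho>}. deriv (deriv \<psi>) x \<le> - m)"
proof -
  let ?d1 = "deriv \<psi>" and ?d2 = "deriv (deriv \<psi>)"
  have per1: "?d1 (x + 1) = ?d1 x" for x
    using C2 by (intro deriv_periodic) (auto simp: C2_circle_function_def)
  have per2: "?d2 (x + 1) = ?d2 x" for x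
    using C2 per1 by (intro deriv_periodic) (auto simp: C2_circle_function_def)
  have c1: "continuous_on S ?d1" for S
    using C2 by (auto simp: C2_circle_function_def intro!: continuous_at_imp_continuous_on differentiable_imp_continuous_within)
  have c2: "continuous_on S ?d2" for S
    using C2 by (auto simp: C2_circle_function_def intro: continuous_on_subset)
  have "continuous_on {0..1} (\<lambda>x. \<bar>?d1 x\<bar> + \<bar>?d2 x\<bar>)"
    by (intro continuous_intros c1 c2)
  then obtain x0 where x0: "x0 \<in> {0..1}" "\<And>x. x \<in> {0..1} \<Longrightarrow> \<bar>?d1 x0\<bar> + \<bar>?d2 x0\<bar> \<le> \<bar>?d1 x\<bar> + \<bar>?d2 x\<bar>"
    using continuous_attains_inf[of "{0..1::real}" "\<lambda>x. \<bar>?d1 x\<bar> + \<bar>?d2 x\<bar>"] by auto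
  define m where "m = (\<bar>?d1 x0\<bar> + \<bar>?d2 x0\<bar>) / 4"
  have "m > 0"
  proof -
    have "?d1 x \<noteq> 0 \<or> ?d2 x \<noteq> 0" if "0 \<le> x" "x < 1" for x
      using crit that unfolding critical_points_def by auto
    \<comment> \<open>The minimum may sit at 1, a point that \<open>critical_points\<close>
      represents by 0.\<close>
    then have "?d1 x0 \<noteq> 0 \<or> ?d2 x0 \<noteq> 0"
      using x0(1) per1[of 0] per2[of 0] by (cases "x0 = 1") auto
    then show ?thesis unfolding m_def by auto
  qed
  \<comment> \<open>An arc of length at most 1 that starts in [0,1) stays inside [0,2].\<close>
  have "uniformly_continuous_on {0..2} ?d1" "uniformly_continuous_on {0..2} ?d2"
    by (auto intro!: compact_uniformly_continuous c1 c2)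
  then obtain r1 r2 where r: "r1 > 0" "r2 > 0"
    "\<And>x y. x \<in> {0..2} \<Longrightarrow> y \<in> {0..2} \<Longrightarrow> dist y x < r1 \<Longrightarrow> dist (?d1 y) (?d1 x) < m"
    "\<And>x y. x \<in> {0..2} \<Longrightarrow> y \<in> {0..2} \<Longrightarrow> dist y x < r2 \<Longrightarrow> dist (?d2 y) (?d2 x) < m"
    unfolding uniformly_continuous_on_def using \<open>m > 0\<close> by (metis (no_types, lifting))
  define \<rho> where "\<rho> = min 1 (min r1 r2 / 2)"
  have \<rho>: "\<rho> > 0" "\<rho> \<le> 1" "\<rho> < r1" "\<rho> < r2" using r(1,2) unfolding \<rho>_def by auto
  have main: "(\<forall>x\<in>{u..u+\<rho>}. ?d1 x \<ge> m) \<or> (\<forall>x\<in>{u..u+\<rho>}. ?d1 x \<le> - m) \<or>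
      (\<forall>x\<in>{u..u+\<rho>}. ?d2 x \<ge> m) \<or> (\<forall>x\<in>{u..u+\<rho>}. ?d2 x \<le> - m)" for u
  proof -
    define v where "v = frac u"
    have v: "0 \<le> v" "v < 1" by (auto simp: v_def frac_lt_1)
    have shift: "?d1 x = ?d1 (x - of_int \<lfloor>u\<rfloor>)" "?d2 x = ?d2 (x - of_int \<lfloor>u\<rfloor>)" for x
      using periodic_int[of ?d1 x "- \<lfloor>u\<rfloor>"] periodic_int[of ?d2 x "- \<lfloor>u\<rfloor>"] per1 per2 by auto
    have near: "\<bar>?d1 x - ?d1 v\<bar> < m" "\<bar>?d2 x - ?d2 v\<bar> < m" if "x \<in> {u..u+\<rho>}" for x
    proof -
      let ?y = "x - of_int \<lfloor>u\<rfloor>"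
      have y: "v \<le> ?y" "?y \<le> v + \<rho>" using that by (auto simp: v_def frac_def)
      then have "dist ?y v < r1" "dist ?y v < r2" "?y \<in> {0..2}" "v \<in> {0..2}"
        using \<rho> v by (auto simp: dist_real_def)
      then show "\<bar>?d1 x - ?d1 v\<bar> < m" "\<bar>?d2 x - ?d2 v\<bar> < m"
        unfolding shift[of x] using r(3)[of v ?y] r(4)[of v ?y] by (auto simp: dist_real_def)
    qed
    have "4 * m \<le> \<bar>?d1 v\<bar> + \<bar>?d2 v\<bar>" using x0(2)[of v] v by (simp add: m_def)
    then consider "?d1 v \<ge> 2 * m" | "?d1 v \<le> - (2 * m)" | "?d2 v \<ge> 2 * m" | "?d2 v \<le> - (2 * m)"
      by linarith
    then show ?thesis
    proof cases
      case 1
      then have "?d1 x \<ge> m" if "x \<in> {u..u+\<rho>}" for x using near(1)[OF that] by linarith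
      then show ?thesis by blast
    next
      case 2
      then have "?d1 x \<le> - m" if "x \<in> {u..u+\<rho>}" for x using near(1)[OF that] by linarith
      then show ?thesis by blast
    next
      case 3
      then have "?d2 x \<ge> m" if "x \<in> {u..u+\<rho>}" for x using near(2)[OF that] by linarith
      then show ?thesis by blast
    next
      case 4
      then have "?d2 x \<le> - m" if "x \<in> {u..u+\<rho>}" for x using near(2)[OF that] by linarith
      then show ?thesis by blast
    qed
  qed
  from \<open>m > 0\<close> \<rho>(1,2) main show ?thesis by (rule that)
qed

section \<open>Expanding branches and sublevel sets of the derivative\<close>

locale nondegenerate_circle_function =
  fixes \<psi> :: "real \<Rightarrow> real" and m \<rho> L :: real
  assumes C2: "C2_circle_function \<psi>" and m_pos: "m > 0" and \<rho>_pos: "0 < \<rho>" and \<rho>_le_1: "\<rho> \<le> 1"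
    and nondegenerate: "\<And>u. (\<forall>x\<in>{u..u+\<rho>}. deriv \<psi> x \<ge> m) \<or> (\<forall>x\<in>{u..u+\<rho>}. deriv \<psi> x \<le> - m) \<or>
      (\<forall>x\<in>{u..u+\<rho>}. deriv (deriv \<psi>) x \<ge> m) \<or> (\<forall>x\<in>{u..u+\<rho>}. deriv (deriv \<psi>) x \<le> - m)"
    and L_large: "L * m \<ge> 2"
begin

lemma L_pos: "L > 0"
  using L_large m_pos by (smt (verit) mult_nonpos_nonneg)

abbreviation g where "g \<equiv> tau_deriv \<psi> L"

lemma deriv_g: "(g has_real_derivative L * deriv (deriv \<psi>) x) (at x)"
proof -
  have "(deriv \<psi> has_real_derivative deriv (deriv \<psi>) x) (at x)"
    using C2 by (simp add: C2_circle_function_def DERIV_deriv_iff_real_differentiable)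
  then show ?thesis
    unfolding tau_deriv_def[abs_def] by (auto intro!: derivative_eq_intros)
qed

lemma g_measurable [measurable]: "g \<in> borel_measurable borel"
  using deriv_g by (intro borel_measurable_continuous_onI continuous_at_imp_continuous_on) (auto intro: DERIV_isCont)

text \<open>Where \<open>deriv \<psi>\<close> is large, \<open>L * m \<ge> 2\<close> lets half of
  \<open>L * m\<close> absorb the summand 1 of \<open>tau_deriv\<close>. Where the second derivative
  is large, the mean value theorem makes \<open>g\<close> steep; steepness is stated through
  increments because later arguments compare \<open>g\<close> at two points.\<close>

lemma g_trichotomy:
  "(\<forall>x\<in>{u..u+\<rho>}. g x \<ge> L * m / 2) \<or> (\<forall>x\<in>{u..u+\<rho>}. g x \<le> - (L * m / 2)) \<or>
   (\<forall>x y. u \<le> x \<and> x \<le> y \<and> y \<le> u+\<rho> \<longrightarrow> g y - g x \<ge> L * m * (y - x)) \<or>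
   (\<forall>x y. u \<le> x \<and> x \<le> y \<and> y \<le> u+\<rho> \<longrightarrow> g y - g x \<le> - (L * m * (y - x)))"
proof -
  have mvt: "\<exists>z. x \<le> z \<and> z \<le> y \<and> g y - g x = (y - x) * (L * deriv (deriv \<psi>) z)" if "x \<le> y" for x y
  proof (cases "x = y")
    case False
    with that obtain z where "x < z" "z < y" "g y - g x = (y - x) * (L * deriv (deriv \<psi>) z)"
      using MVT2[of x y g "\<lambda>x. L * deriv (deriv \<psi>) x"] deriv_g by auto
    then show ?thesis by (intro exI[of _ z]) auto
  qed auto
  consider "\<forall>x\<in>{u..u+\<rho>}. deriv \<psi> x \<ge> m" | "\<forall>x\<in>{u..u+\<rho>}. deriv \<psi> x \<le> - m"
    | "\<forall>x\<in>{u..u+\<rho>}. deriv (deriv \<psi>) x \<ge> m" | "\<forall>x\<in>{u..u+\<rho>}. deriv (deriv \<psi>) x \<le> - m"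
    using nondegenerate[of u] by blast
  then show ?thesis
  proof cases
    case 1
    have "g x \<ge> L * m / 2" if "x \<in> {u..u+\<rho>}" for x
    proof -
      have "L * m \<le> L * deriv \<psi> x" using 1 that L_pos by (intro mult_left_mono) auto
      then show ?thesis using L_large unfolding tau_deriv_def by linarith
    qed
    then show ?thesis by blast
  next
    case 2
    have "g x \<le> - (L * m / 2)" if "x \<in> {u..u+\<rho>}" for x
    proof -
      have "L * deriv \<psi> x \<le> L * (- m)" using 2 that L_pos by (intro mult_left_mono) auto
      then show ?thesis using L_large unfolding tau_deriv_def by simp
    qed
    then show ?thesis by blast
  next
    case 3
    have "g y - g x \<ge> L * m * (y - x)" if xy: "u \<le> x" "x \<le> y" "y \<le> u+\<rho>" for x y
    proof -
      obtain z where z: "x \<le> z" "z \<le> y" "g y - g x = (y - x) * (L * deriv (deriv \<psi>) z)"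
        using mvt[OF xy(2)] by blast
      have "(y - x) * (L * m) \<le> (y - x) * (L * deriv (deriv \<psi>) z)"
        using 3 z xy L_pos by (intro mult_left_mono) auto
      then show ?thesis using z(3) by (simp add: mult.commute)
    qed
    then show ?thesis by blast
  next
    case 4
    have "g y - g x \<le> - (L * m * (y - x))" if xy: "u \<le> x" "x \<le> y" "y \<le> u+\<rho>" for x y
    proof -
      obtain z where z: "x \<le> z" "z \<le> y" "g y - g x = (y - x) * (L * deriv (deriv \<psi>) z)"
        using mvt[OF xy(2)] by blast
      have "(y - x) * (L * deriv (deriv \<psi>) z) \<le> (y - x) * (L * (- m))"
        using 4 z xy L_pos by (intro mult_left_mono) auto
      then show ?thesis using z(3) by (simp add: mult.commute)
    qed
    then show ?thesis by blast
  qed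
qed

text \<open>In the steep cases the sign of \<open>g\<close> at the midpoint decides: on the side
  where \<open>g\<close> moves away from zero, every point of the outer quarter is at distance at
  least \<open>r / 4\<close> from the midpoint, and \<open>g\<close> has grown accordingly.\<close>

lemma g_large_on_quarter:
  assumes "0 < r" "r \<le> \<rho>"
  shows "\<exists>p q. u \<le> p \<and> q \<le> u + r \<and> q - p \<ge> r / 4 \<and>
    ((\<forall>x\<in>{p..q}. g x \<ge> L * m * r / 4) \<or> (\<forall>x\<in>{p..q}. g x \<le> - (L * m * r / 4)))"
proof -
  have Lm: "L * m > 0" using L_large by linarith
  have r2: "L * m * r / 4 \<le> L * m / 2"
    using mult_left_mono[of r 2 "L * m"] Lm assms \<rho>_le_1 by auto
  let ?w = "u + r / 2"
  have I: ?thesis if "u \<le> p" "q \<le> u + r" "q - p \<ge> r / 4"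
    "(\<forall>x\<in>{p..q}. g x \<ge> L * m * r / 4) \<or> (\<forall>x\<in>{p..q}. g x \<le> - (L * m * r / 4))" for p q
    using that by blast
  have lower: "L * m * d \<ge> L * m * r / 4" if "d \<ge> r / 4" for d
    using mult_left_mono[OF that, of "L * m"] Lm by simp
  consider "\<forall>x\<in>{u..u+\<rho>}. g x \<ge> L * m / 2" | "\<forall>x\<in>{u..u+\<rho>}. g x \<le> - (L * m / 2)"
    | (up) "\<And>x y. u \<le> x \<Longrightarrow> x \<le> y \<Longrightarrow> y \<le> u+\<rho> \<Longrightarrow> g y - g x \<ge> L * m * (y - x)"
    | (down) "\<And>x y. u \<le> x \<Longrightarrow> x \<le> y \<Longrightarrow> y \<le> u+\<rho> \<Longrightarrow> g y - g x \<le> - (L * m * (y - x))"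
    using g_trichotomy[of u] by blast
  then show ?thesis
  proof cases
    case 1
    have "g x \<ge> L * m * r / 4" if "x \<in> {u..u+r}" for x
    proof -
      have "g x \<ge> L * m / 2" using 1 that assms by auto
      then show ?thesis using r2 by linarith
    qed
    then show ?thesis using assms
      by (intro I[of u "u + r"] disjI1 ballI) auto
  next
    case 2
    have "g x \<le> - (L * m * r / 4)" if "x \<in> {u..u+r}" for x
    proof -
      have "g x \<le> - (L * m / 2)" using 2 that assms by auto
      then show ?thesis using r2 by linarith
    qed
    then show ?thesis using assms
      by (intro I[of u "u + r"] disjI2 ballI) auto
  next
    case up
    show ?thesis
    proof (cases "g ?w \<ge> 0")
      case True
      have "g x \<ge> L * m * r / 4" if "x \<in> {u + 3 * r / 4..u + r}" for x
        using up[of ?w x] lower[of "x - ?w"] that assms True by auto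
      then show ?thesis using assms
        by (intro I[of "u + 3 * r / 4" "u + r"] disjI1 ballI) auto
    next
      case False
      have "g x \<le> - (L * m * r / 4)" if "x \<in> {u..u + r / 4}" for x
        using up[of x ?w] lower[of "?w - x"] that assms False by auto
      then show ?thesis using assms
        by (intro I[of u "u + r / 4"] disjI2 ballI) auto
    qed
  next
    case down
    show ?thesis
    proof (cases "g ?w \<ge> 0")
      case True
      have "g x \<ge> L * m * r / 4" if "x \<in> {u..u + r / 4}" for x
        using down[of x ?w] lower[of "?w - x"] that assms True by auto
      then show ?thesis using assms
        by (intro I[of u "u + r / 4"] disjI1 ballI) auto
    next
      case False
      have "g x \<le> - (L * m * r / 4)" if "x \<in> {u + 3 * r / 4..u + r}" for x
        using down[of ?w x] lower[of "x - ?w"] that assms False by auto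
      then show ?thesis using assms
        by (intro I[of "u + 3 * r / 4" "u + r"] disjI2 ballI) auto
    qed
  qed
qed

text \<open>A piece of length \<open>r / 4\<close> on which the slope is at least
  \<open>L * m * r / 4\<close> has an image of length at least
  \<open>L * m * r\<^sup>2 / 16\<close>. With \<open>r = \<rho> * l\<close> this is
  \<open>l / 16\<close> times the quantity assumed to be at least 32.\<close>

lemma expanding_branch:
  assumes deriv: "\<And>x. (F has_real_derivative g x) (at x)"
    and "0 < l" "l \<le> 1" and large: "L * l * m * \<rho>\<^sup>2 \<ge> 32"
  shows "\<exists>p q. u \<le> p \<and> p < q \<and> q \<le> u + l \<and> \<bar>F q - F p\<bar> \<ge> 2 * l \<and>
      ((\<forall>x\<in>{p..q}. g x \<ge> 0) \<or> (\<forall>x\<in>{p..q}. g x \<le> 0))"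
proof -
  \<comment> \<open>The product is at most \<open>\<rho>\<close>, as the quarter lemma demands, and
    at most \<open>l\<close>, so that the branch stays in the given arc.\<close>
  define r where "r = \<rho> * l"
  define s where "s = L * m * r / 4"
  have r: "0 < r" "r \<le> \<rho>" "r \<le> l"
    using \<rho>_pos \<rho>_le_1 assms(2,3) unfolding r_def
    by (auto intro: mult_left_le mult_left_le_one_le)
  have s: "s > 0" unfolding s_def using L_pos m_pos r(1) by simp
  obtain p q where pq: "u \<le> p" "q \<le> u + r" "q - p \<ge> r / 4"
    and sign: "(\<forall>x\<in>{p..q}. g x \<ge> s) \<or> (\<forall>x\<in>{p..q}. g x \<le> - s)"
    using g_large_on_quarter[OF r(1,2), of u] unfolding s_def by blast
  have "p < q" using pq(3) r(1) by linarith
  then obtain z where z: "p < z" "z < q" "F q - F p = (q - p) * g z"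
    using MVT2[of p q F g] deriv by auto
  have "\<bar>g z\<bar> \<ge> s"
    using sign
  proof
    assume "\<forall>x\<in>{p..q}. g x \<ge> s"
    then have "g z \<ge> s" using z by simp
    then show ?thesis by simp
  next
    assume "\<forall>x\<in>{p..q}. g x \<le> - s"
    then have "g z \<le> - s" using z by simp
    then show ?thesis by simp
  qed
  then have "\<bar>F q - F p\<bar> \<ge> (r / 4) * s"
    unfolding z(3) abs_mult using pq(3) r(1) s by (intro mult_mono) auto
  moreover have "(r / 4) * s = l * (L * l * m * \<rho>\<^sup>2) / 16"
    by (simp add: r_def s_def power2_eq_square)
  moreover have "l * (L * l * m * \<rho>\<^sup>2) \<ge> l * 32"
    using large assms(2) by (intro mult_left_mono) auto
  ultimately have "\<bar>F q - F p\<bar> \<ge> 2 * l" by linarith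
  moreover have "(\<forall>x\<in>{p..q}. g x \<ge> 0) \<or> (\<forall>x\<in>{p..q}. g x \<le> 0)"
    using sign
  proof (elim disjE)
    assume "\<forall>x\<in>{p..q}. g x \<ge> s"
    then show ?thesis using s by (intro disjI1) (auto intro: order_trans[of 0 s])
  next
    assume "\<forall>x\<in>{p..q}. g x \<le> - s"
    then show ?thesis using s by (intro disjI2) (auto intro: order_trans[of _ "- s" 0])
  qed
  moreover have "q \<le> u + l" using pq(2) r(3) by linarith
  ultimately show ?thesis using pq(1) \<open>p < q\<close> by blast
qed

text \<open>In the steep cases the set lies within \<open>2 * s / m\<close> of any of its points. If
  \<open>g\<close> is large on the whole arc, a single point of the set forces
  \<open>m \<le> 2 * s\<close>, and then the bound exceeds the length \<open>\<rho> \<le> 1\<close>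
  of the arc.\<close>

lemma sublevel_local:
  assumes "s > 0"
  shows "emeasure lborel {x\<in>{u..u+\<rho>}. \<bar>g x\<bar> \<le> L * s} \<le> ennreal (4 * s / m)"
proof (cases "{x\<in>{u..u+\<rho>}. \<bar>g x\<bar> \<le> L * s} = {}")
  case True
  show ?thesis unfolding True by simp
next
  case False
  let ?S = "{x\<in>{u..u+\<rho>}. \<bar>g x\<bar> \<le> L * s}"
  obtain x0 where x0: "u \<le> x0" "x0 \<le> u + \<rho>" "\<bar>g x0\<bar> \<le> L * s" using False by auto
  have spread: "?S \<subseteq> {x0 - 2 * s / m..x0 + 2 * s / m}"
    if steep: "\<And>x y. u \<le> x \<Longrightarrow> x \<le> y \<Longrightarrow> y \<le> u+\<rho> \<Longrightarrow> \<bar>g y - g x\<bar> \<ge> L * m * (y - x)"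
  proof
    fix x assume x: "x \<in> ?S"
    have "L * m * \<bar>x - x0\<bar> \<le> \<bar>g x - g x0\<bar>"
      using steep[of x x0] steep[of x0 x] x x0 by (cases "x \<le> x0") auto
    also have "\<dots> \<le> L * (2 * s)" using x x0(3) by auto
    finally have "m * \<bar>x - x0\<bar> \<le> 2 * s" using L_pos by (simp add: mult.assoc)
    then have "\<bar>x - x0\<bar> \<le> 2 * s / m" using m_pos by (simp add: field_simps)
    then show "x \<in> {x0 - 2 * s / m..x0 + 2 * s / m}" by (auto simp: abs_le_iff)
  qed
  have whole: "\<rho> \<le> 4 * s / m" if "\<And>x. x \<in> {u..u+\<rho>} \<Longrightarrow> \<bar>g x\<bar> \<ge> L * m / 2"
  proof -
    have "L * m / 2 \<le> L * s" using that[of x0] x0 by auto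
    then have "m \<le> 2 * s" using L_pos by (simp add: field_simps)
    then have "1 \<le> 4 * s / m" using m_pos by (simp add: field_simps)
    then show ?thesis using \<rho>_le_1 by linarith
  qed
  have S: "?S \<subseteq> {u..u+\<rho>}" by auto
  have "?S \<subseteq> {x0 - 2 * s / m..x0 + 2 * s / m} \<or> \<rho> \<le> 4 * s / m"
    using g_trichotomy[of u]
  proof (elim disjE)
    assume "\<forall>x\<in>{u..u+\<rho>}. g x \<ge> L * m / 2"
    then show ?thesis by (intro disjI2 whole) force
  next
    assume "\<forall>x\<in>{u..u+\<rho>}. g x \<le> - (L * m / 2)"
    then show ?thesis by (intro disjI2 whole) force
  next
    assume *: "\<forall>x y. u \<le> x \<and> x \<le> y \<and> y \<le> u+\<rho> \<longrightarrow> g y - g x \<ge> L * m * (y - x)"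
    have "\<bar>g y - g x\<bar> \<ge> L * m * (y - x)" if "u \<le> x" "x \<le> y" "y \<le> u+\<rho>" for x y
      using *[rule_format, of x y] that by linarith
    then show ?thesis by (intro disjI1 spread)
  next
    assume *: "\<forall>x y. u \<le> x \<and> x \<le> y \<and> y \<le> u+\<rho> \<longrightarrow> g y - g x \<le> - (L * m * (y - x))"
    have "\<bar>g y - g x\<bar> \<ge> L * m * (y - x)" if "u \<le> x" "x \<le> y" "y \<le> u+\<rho>" for x y
      using *[rule_format, of x y] that by linarith
    then show ?thesis by (intro disjI1 spread)
  qed
  then show ?thesis
  proof
    assume "?S \<subseteq> {x0 - 2 * s / m..x0 + 2 * s / m}"
    then have "emeasure lborel ?S \<le> emeasure lborel {x0 - 2 * s / m..x0 + 2 * s / m}"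
      by (rule emeasure_mono) simp
    then show ?thesis using assms m_pos by (simp add: field_simps)
  next
    assume "\<rho> \<le> 4 * s / m"
    have "emeasure lborel ?S \<le> emeasure lborel {u..u+\<rho>}" by (rule emeasure_mono[OF S]) simp
    also have "\<dots> = ennreal \<rho>" using \<rho>_pos by simp
    also have "\<dots> \<le> ennreal (4 * s / m)" by (rule ennreal_leI) fact
    finally show ?thesis .
  qed
qed

text \<open>The circle is covered by finitely many arcs of length \<open>\<rho>\<close>, each
  contributing the local bound. The threshold \<open>L * s\<close> amounts to
  \<open>deriv \<psi>\<close> being within \<open>s\<close> of \<open>- 1 / L\<close>, which keeps
  the constant free of \<open>L\<close>.\<close>

lemma sublevel:
  assumes "s > 0"
  shows "emeasure circle_lebesgue {x\<in>{0..<1}. \<bar>g x\<bar> \<le> L * s}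
    \<le> ennreal (of_nat (nat \<lceil>1 / \<rho>\<rceil>) * (4 / m) * s)"
proof -
  define N where "N = nat \<lceil>1 / \<rho>\<rceil>"
  let ?S = "\<lambda>i. {x\<in>{real i * \<rho>..real i * \<rho> + \<rho>}. \<bar>g x\<bar> \<le> L * s}"
  have cover: "{x\<in>{0..<1}. \<bar>g x\<bar> \<le> L * s} \<subseteq> (\<Union>i<N. ?S i)"
  proof
    fix x assume x: "x \<in> {x\<in>{0..<1}. \<bar>g x\<bar> \<le> L * s}"
    define i where "i = nat \<lfloor>x / \<rho>\<rfloor>"
    have "x / \<rho> \<ge> 0" using x \<rho>_pos by auto
    then have i: "real i \<le> x / \<rho>" "x / \<rho> < real i + 1" unfolding i_def by linarith+
    then have "real i * \<rho> \<le> x" "x \<le> real i * \<rho> + \<rho>" using \<rho>_pos by (auto simp: field_simps)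
    moreover have "i < N"
    proof -
      have "x / \<rho> < 1 / \<rho>" using x \<rho>_pos by (intro divide_strict_right_mono) auto
      with i(1) have "real i < 1 / \<rho>" by linarith
      then show ?thesis unfolding N_def by linarith
    qed
    ultimately show "x \<in> (\<Union>i<N. ?S i)" using x by auto
  qed
  have meas: "?S i \<in> sets lborel" for i by measurable
  have "emeasure circle_lebesgue {x\<in>{0..<1}. \<bar>g x\<bar> \<le> L * s} = emeasure lborel {x\<in>{0..<1}. \<bar>g x\<bar> \<le> L * s}"
    unfolding circle_lebesgue_def by (rule emeasure_restrict_space) auto
  also have "\<dots> \<le> emeasure lborel (\<Union>i<N. ?S i)"
    by (rule emeasure_mono[OF cover]) (use meas in blast)
  also have "\<dots> \<le> (\<Sum>i<N. emeasure lborel (?S i))"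
    by (rule emeasure_subadditive_finite) (use meas in auto)
  also have "\<dots> \<le> (\<Sum>i<N. ennreal (4 * s / m))"
    by (intro sum_mono sublevel_local assms)
  also have "\<dots> = ennreal (of_nat N * (4 / m) * s)"
    using assms m_pos by (simp add: ennreal_of_nat_eq_real_of_nat ennreal_mult'[symmetric])
  finally show ?thesis unfolding N_def .
qed

end

section \<open>The Lyapunov exponent\<close>

text \<open>Summing the dyadic sublevel sets replaces the layer-cake formula for the logarithm.\<close>
lemma ln_inverse_le_dyadic_count:
  fixes t :: real
  assumes "t \<noteq> 0"
  shows "ennreal (- ln \<bar>t\<bar>) \<le> (\<Sum>k. indicator {y. \<bar>y\<bar> \<le> (1 / 2) ^ k} t)"
proof (cases "\<bar>t\<bar> \<le> 1")
  case False
  then have "- ln \<bar>t\<bar> \<le> 0" by simp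
  then show ?thesis by (simp add: ennreal_neg)
next
  case True
  \<comment> \<open>All indicators with index below \<open>n\<close> equal 1, while
    \<open>- ln \<bar>t\<bar>\<close> is below \<open>n * ln 2\<close>; bounding \<open>ln 2\<close>
    by 1 leaves a plain count.\<close>
  define n where "n = (LEAST n. (1 / 2) ^ n < \<bar>t\<bar>)"
  have ex: "\<exists>n. (1 / 2) ^ n < \<bar>t\<bar>" using real_arch_pow_inv[of "\<bar>t\<bar>" "1 / 2"] assms by auto
  have n: "(1 / 2) ^ n < \<bar>t\<bar>" "\<And>k. k < n \<Longrightarrow> \<bar>t\<bar> \<le> (1 / 2) ^ k"
    unfolding n_def using LeastI_ex[OF ex] not_less_Least[of _ "\<lambda>n. (1 / 2) ^ n < \<bar>t\<bar>"]
    by (auto simp: not_less)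
  have "- ln \<bar>t\<bar> \<le> real n"
  proof -
    have "ln ((1 / 2) ^ n) \<le> ln \<bar>t\<bar>" using n(1) assms by simp
    moreover have "ln ((1 / 2) ^ n) = - (real n * ln 2)" by (simp add: ln_realpow ln_div)
    moreover have "real n * ln 2 \<le> real n * 1" by (intro mult_left_mono) (use ln_2_less_1 in auto)
    ultimately show ?thesis by linarith
  qed
  then have "ennreal (- ln \<bar>t\<bar>) \<le> ennreal (real n)" by (rule ennreal_leI)
  also have "\<dots> = (\<Sum>k<n. indicator {y. \<bar>y\<bar> \<le> (1 / 2) ^ k} t)"
    using n(2) by (simp add: ennreal_of_nat_eq_real_of_nat)
  also have "\<dots> \<le> (\<Sum>k. indicator {y. \<bar>y\<bar> \<le> (1 / 2) ^ k} t)"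
    by (rule sum_le_suminf) auto
  finally show ?thesis .
qed

lemma log_abs_measurable [measurable]: "log_abs \<in> borel_measurable borel"
  unfolding log_abs_def[abs_def] by measurable

text \<open>The dyadic count \<open>S\<close> of \<open>h x / R\<close> dominates the deficit of the
  logarithm below \<open>ln R\<close>, and its integral is at most the geometric sum of
  \<open>K * (1 / 2) ^ k\<close>, that is \<open>2 * K\<close>.\<close>

lemma ereal_integral_log_abs_ge:
  fixes h :: "'a \<Rightarrow> real" and K R :: real
  assumes "prob_space \<mu>" and h [measurable]: "h \<in> borel_measurable \<mu>"
    and "R \<ge> 1" and "K \<ge> 0"
    and small: "\<And>s. s > 0 \<Longrightarrow> emeasure \<mu> {x\<in>space \<mu>. \<bar>h x\<bar> \<le> R * s} \<le> ennreal (K * s)"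
  shows "ereal_integral \<mu> (\<lambda>x. log_abs (h x)) \<ge> ereal (ln R - 2 * K)"
proof -
  interpret prob_space \<mu> by fact
  define S where "S x = (\<Sum>k. indicator {y. \<bar>y\<bar> \<le> (1 / 2) ^ k} (h x / R) :: ennreal)" for x
  have [measurable]: "S \<in> borel_measurable \<mu>" unfolding S_def[abs_def] by measurable
  define P where "P = (\<integral>\<^sup>+ x. e2ennreal (log_abs (h x)) \<partial>\<mu>)"
  define Q where "Q = (\<integral>\<^sup>+ x. e2ennreal (- log_abs (h x)) \<partial>\<mu>)"
  have R: "R > 0" "ln R \<ge> 0" using \<open>R \<ge> 1\<close> by auto
  have S_int: "(\<integral>\<^sup>+ x. S x \<partial>\<mu>) \<le> ennreal (2 * K)"
  proof -
    have "(\<integral>\<^sup>+ x. S x \<partial>\<mu>) = (\<Sum>k. \<integral>\<^sup>+ x. indicator {y. \<bar>y\<bar> \<le> (1 / 2) ^ k} (h x / R) \<partial>\<mu>)"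
      unfolding S_def by (rule nn_integral_suminf) measurable
    also have "\<dots> \<le> (\<Sum>k. ennreal (K * (1 / 2) ^ k))"
    proof (rule suminf_le)
      fix k
      have "(\<integral>\<^sup>+ x. indicator {y. \<bar>y\<bar> \<le> (1 / 2) ^ k} (h x / R) \<partial>\<mu>) =
          (\<integral>\<^sup>+ x. indicator {x\<in>space \<mu>. \<bar>h x\<bar> \<le> R * (1 / 2) ^ k} x \<partial>\<mu>)"
        using R by (intro nn_integral_cong) (auto simp: indicator_def field_simps)
      also have "\<dots> = emeasure \<mu> {x\<in>space \<mu>. \<bar>h x\<bar> \<le> R * (1 / 2) ^ k}"
        by (rule nn_integral_indicator) measurable
      also have "\<dots> \<le> ennreal (K * (1 / 2) ^ k)" by (rule small) simp
      finally show "(\<integral>\<^sup>+ x. indicator {y. \<bar>y\<bar> \<le> (1 / 2) ^ k} (h x / R) \<partial>\<mu>) \<le> ennreal (K * (1 / 2) ^ k)" .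
    qed auto
    also have "\<dots> = ennreal (2 * K)"
    proof -
      have "(\<lambda>k. K * (1 / 2) ^ k) sums (K * 2)"
        using geometric_sums[of "1 / 2 :: real"] by (intro sums_mult) simp
      then show ?thesis
        using \<open>K \<ge> 0\<close> by (subst suminf_ennreal2) (auto simp: sums_iff mult.commute)
    qed
    finally show ?thesis .
  qed
  \<comment> \<open>The inequality between \<open>ln R\<close>, the logarithm and \<open>S\<close>,
    with the negative part moved across so that no subtraction in \<open>ennreal\<close> occurs. The
    second conjunct makes \<open>Q\<close> finite, so that it may be subtracted at the end.\<close>
  have pw: "ennreal (ln R) + e2ennreal (- log_abs (h x)) \<le> e2ennreal (log_abs (h x)) + S x \<and>
      e2ennreal (- log_abs (h x)) \<le> S x" for x
  proof (cases "h x = 0")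
    \<comment> \<open>Here the logarithm is \<open>-\<infinity>\<close>, and \<open>S x\<close> is
      infinite as well because every dyadic indicator equals 1 at 0.\<close>
    case True
    have "S x = \<top>"
    proof -
      have "of_nat n \<le> S x" for n
      proof -
        have "(\<Sum>k<n. 1) \<le> S x"
          unfolding S_def using True by (intro order_trans[OF _ sum_le_suminf[of _ "{..<n}"]] sum_mono) auto
        then show ?thesis by simp
      qed
      then show ?thesis
        using ennreal_SUP_of_nat_eq_top by (metis SUP_least top_unique)
    qed
    then show ?thesis by simp
  next
    case False
    define y where "y = ln \<bar>h x\<bar>"
    have log: "log_abs (h x) = ereal y" using False by (simp add: log_abs_def y_def)
    have "ln R - y = - ln \<bar>h x / R\<bar>"
      using False R by (simp add: y_def abs_divide ln_div)
    then have S: "ennreal (ln R - y) \<le> S x"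
      using ln_inverse_le_dyadic_count[of "h x / R"] False R by (simp add: S_def)
    show ?thesis
    proof (cases "y \<ge> 0")
      case True
      have "ennreal (ln R) \<le> ennreal (y + max 0 (ln R - y))" by (intro ennreal_leI) auto
      also have "\<dots> = ennreal y + ennreal (ln R - y)"
        using True by (cases "ln R \<ge> y") (auto simp: ennreal_neg max_def simp flip: ennreal_plus)
      also have "\<dots> \<le> ennreal y + S x" by (intro add_left_mono S)
      finally show ?thesis using True by (simp add: log ennreal_neg)
    next
      case neg: False
      have "ennreal (ln R) + ennreal (- y) = ennreal (ln R - y)"
        using neg R by (simp flip: ennreal_plus)
      moreover have "ennreal (- y) \<le> ennreal (ln R - y)" using R by (intro ennreal_leI) simp
      ultimately show ?thesis using S neg by (auto simp: log ennreal_neg intro: order_trans)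
    qed
  qed
  have "Q \<le> (\<integral>\<^sup>+ x. S x \<partial>\<mu>)" unfolding Q_def using pw by (intro nn_integral_mono) auto
  then have "Q \<le> ennreal (2 * K)" using S_int by (rule order_trans)
  then obtain q where q: "Q = ennreal q" "q \<ge> 0" by (cases Q) (auto simp: top_unique)
  have "ennreal (ln R) + Q = (\<integral>\<^sup>+ x. ennreal (ln R) + e2ennreal (- log_abs (h x)) \<partial>\<mu>)"
    unfolding Q_def by (subst nn_integral_add) (auto simp: emeasure_space_1)
  also have "\<dots> \<le> (\<integral>\<^sup>+ x. e2ennreal (log_abs (h x)) + S x \<partial>\<mu>)"
    using pw by (intro nn_integral_mono) auto
  also have "\<dots> = P + (\<integral>\<^sup>+ x. S x \<partial>\<mu>)"
    unfolding P_def by (rule nn_integral_add) measurable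
  also have "\<dots> \<le> P + ennreal (2 * K)" by (intro add_left_mono S_int)
  finally have main: "ennreal (ln R) + Q \<le> P + ennreal (2 * K)" .
  have "ereal (ln R - 2 * K) \<le> enn2ereal P - enn2ereal Q"
  proof (cases P)
    case (real p)
    then have "ln R + q \<le> p + 2 * K"
      using main q R \<open>K \<ge> 0\<close> by (simp flip: ennreal_plus)
    then show ?thesis using real q by (simp add: enn2ereal_ennreal)
  next
    case top
    then show ?thesis using q by (simp add: enn2ereal_ennreal)
  qed
  then show ?thesis unfolding ereal_integral_def P_def Q_def .
qed

text \<open>With the density bound \<open>M = 1 + 1 / (2 * \<epsilon>)\<close>, the level
  \<open>R * s\<close> equals \<open>L * (s / M)\<close>, so the factor \<open>M\<close> cancels and
  the Lebesgue constant of \<open>sublevel\<close> serves for the invariant measure too. It depends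
  on \<open>m\<close> and \<open>\<rho>\<close> only, not on \<open>L\<close>, \<open>a\<close> or
  \<open>\<epsilon>\<close>.\<close>

lemma (in nondegenerate_circle_function) unique_ergodic_and_lyapunov_ge:
  assumes "\<epsilon> > 0" and large: "L * \<epsilon> * m * \<rho>\<^sup>2 \<ge> 32"
    and R: "R = L / (1 + 1 / (2 * \<epsilon>))" "R \<ge> 1"
  shows "\<exists>!\<mu>. ergodic_invariant_measure (noise \<epsilon>) (tau_kicked \<psi> L a) \<mu>"
    and "lyapunov_exponent \<psi> \<epsilon> L a \<ge> ereal (ln R - 2 * (of_nat (nat \<lceil>1 / \<rho>\<rceil>) * (4 / m)))"
proof -
  interpret N: noisy_circle_map \<psi> L a \<epsilon>
    by unfold_locales (use C2 \<open>\<epsilon> > 0\<close> in auto)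
  obtain D where D: "\<And>x. \<bar>g x\<bar> \<le> D" using N.tau_deriv_bounded by blast
  show ex1: "\<exists>!\<mu>. ergodic_invariant_measure (noise \<epsilon>) (tau_kicked \<psi> L a) \<mu>"
  proof (rule N.unique_ergodic[OF expanding_branch[OF N.deriv_lift] D])
    fix l :: real assume l: "\<epsilon> < l"
    then show "0 < l" using \<open>\<epsilon> > 0\<close> by linarith
    have "L * \<epsilon> * m * \<rho>\<^sup>2 \<le> L * l * m * \<rho>\<^sup>2"
      using l L_pos m_pos by (intro mult_right_mono mult_left_mono) auto
    then show "L * l * m * \<rho>\<^sup>2 \<ge> 32" using large by linarith
  qed
  define \<mu> where "\<mu> = (THE \<mu>. ergodic_invariant_measure (noise \<epsilon>) (tau_kicked \<psi> L a) \<mu>)"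
  have "ergodic_invariant_measure (noise \<epsilon>) (tau_kicked \<psi> L a) \<mu>"
    unfolding \<mu>_def using ex1 by (rule theI')
  then have inv: "invariant_measure (noise \<epsilon>) (tau_kicked \<psi> L a) \<mu>"
    by (simp add: ergodic_invariant_measure_def)
  then have prob: "prob_space \<mu>" and sets: "sets \<mu> = sets circle"
    by (auto simp: invariant_measure_def)
  have space: "space \<mu> = {0..<1}" using sets_eq_imp_space_eq[OF sets] by simp
  have g [measurable]: "g \<in> borel_measurable circle"
    unfolding circle_def by (rule measurable_restrict_space1) measurable
  define M where "M = 1 + 1 / (2 * \<epsilon>)"
  have M: "M > 0" using \<open>\<epsilon> > 0\<close> by (simp add: M_def add_pos_pos)
  define K where "K = of_nat (nat \<lceil>1 / \<rho>\<rceil>) * (4 / m)"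
  have "ereal (ln R - 2 * K) \<le> ereal_integral \<mu> (\<lambda>x. log_abs (g x))"
  proof (rule ereal_integral_log_abs_ge[OF prob _ R(2)])
    show "g \<in> borel_measurable \<mu>" using g measurable_cong_sets[OF sets refl] by blast
    show "K \<ge> 0" using m_pos by (simp add: K_def)
    fix s :: real assume s: "s > 0"
    define B where "B = {x\<in>{0..<1}. \<bar>g x\<bar> \<le> L * (s / M)}"
    have "B = {x\<in>space circle. \<bar>g x\<bar> \<le> L * (s / M)}" by (simp add: B_def)
    also have "\<dots> \<in> sets circle" by measurable
    finally have B: "B \<in> sets circle" .
    have "{x\<in>space \<mu>. \<bar>g x\<bar> \<le> R * s} = B" by (simp add: B_def space R(1) M_def)
    then have "emeasure \<mu> {x\<in>space \<mu>. \<bar>g x\<bar> \<le> R * s} = (\<integral>\<^sup>+ x. indicator B x \<partial>\<mu>)"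
      using B sets by simp
    also have "\<dots> \<le> ennreal M * (\<integral>\<^sup>+ x. indicator B x \<partial>circle_lebesgue)"
      unfolding M_def by (rule N.invariant_density_bound[OF inv]) (use B in simp)
    also have "\<dots> = ennreal M * emeasure circle_lebesgue B"
      using B by (simp add: sets_circle_lebesgue)
    also have "\<dots> \<le> ennreal M * ennreal (K * (s / M))"
      unfolding B_def K_def by (intro mult_left_mono sublevel) (use s M in auto)
    also have "\<dots> = ennreal (K * s)"
      using M by (simp add: ennreal_mult'[symmetric])
    finally show "emeasure \<mu> {x\<in>space \<mu>. \<bar>g x\<bar> \<le> R * s} \<le> ennreal (K * s)" .
  qed
  then show "lyapunov_exponent \<psi> \<epsilon> L a \<ge> ereal (ln R - 2 * (of_nat (nat \<lceil>1 / \<rho>\<rceil>) * (4 / m)))"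
    unfolding lyapunov_exponent_def lyapunov_integral_def \<mu>_def[symmetric] K_def .
qed

section \<open>Choice of constants and passage to the limit\<close>

theorem theorem2:
  fixes \<psi> :: "real \<Rightarrow> real" and N :: nat and C \<beta> :: real and \<epsilon> :: "real \<Rightarrow> real"
  assumes "C2_circle_function \<psi>"
    and "finite (critical_points \<psi>)" and "card (critical_points \<psi>) = N" and "0 < N"
    and "\<forall>c\<in>critical_points \<psi>. deriv (deriv \<psi>) c \<noteq> 0"
    and "C > 0" and "0 < \<beta>" and "\<beta> \<le> 1"
    and "\<forall>L>0. \<epsilon> L \<ge> C * L powr (\<beta> - 1)"
  shows "(\<forall>\<^sub>F L in at_top. \<forall>a\<in>{0..<1}.
            \<exists>!\<mu>. ergodic_invariant_measure (noise (\<epsilon> L)) (tau_kicked \<psi> L a) \<mu>) \<and>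
         Liminf at_top (\<lambda>L. INF a\<in>{0..<1}. lyapunov_exponent \<psi> (\<epsilon> L) L a / ereal (ln L)) \<ge> ereal \<beta>"
proof -
  obtain m \<rho> :: real where m: "m > 0" and \<rho>: "0 < \<rho>" "\<rho> \<le> 1"
    and nondeg: "\<And>u. (\<forall>x\<in>{u..u+\<rho>}. deriv \<psi> x \<ge> m) \<or> (\<forall>x\<in>{u..u+\<rho>}. deriv \<psi> x \<le> - m) \<or>
      (\<forall>x\<in>{u..u+\<rho>}. deriv (deriv \<psi>) x \<ge> m) \<or> (\<forall>x\<in>{u..u+\<rho>}. deriv (deriv \<psi>) x \<le> - m)"
    using nondegenerate_uniform[OF assms(1,5)] by blast
  \<comment> \<open>Chosen so that the density bound is at most
    \<open>A * L powr (1 - \<beta>)\<close>, whence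
    \<open>R \<ge> L powr \<beta> / A\<close>.\<close>
  define A where "A = 1 + 1 / (2 * C)"
  define K where "K = of_nat (nat \<lceil>1 / \<rho>\<rceil>) * (4 / m)"
  have A: "A > 0" using \<open>C > 0\<close> by (simp add: A_def add_pos_pos)
  have powr_top: "filterlim (\<lambda>L::real. L powr \<beta>) at_top at_top"
    using \<open>0 < \<beta>\<close> by real_asymp
  \<comment> \<open>The four thresholds: 2 makes \<open>ln L\<close> positive, \<open>2 / m\<close>
    gives \<open>L * m \<ge> 2\<close>, \<open>A\<close> gives \<open>R \<ge> 1\<close>, and the
    last one gives the expansion condition with constant 32.\<close>
  have "\<forall>\<^sub>F L in at_top. L \<ge> max 2 (2 / m)"
    by (rule eventually_ge_at_top)
  moreover have "\<forall>\<^sub>F L in at_top. L powr \<beta> \<ge> max A (32 / (C * m * \<rho>\<^sup>2))"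
    using powr_top by (simp only: filterlim_at_top)
  \<comment> \<open>\<open>A\<close> and \<open>K\<close> depend on \<open>\<psi>\<close> and
    \<open>C\<close> only, so the bound holds for all \<open>a\<close> at once beyond a common
    threshold for \<open>L\<close>.\<close>
  ultimately have key: "\<forall>\<^sub>F L in at_top. L \<ge> 2 \<and> (\<forall>a.
      (\<exists>!\<mu>. ergodic_invariant_measure (noise (\<epsilon> L)) (tau_kicked \<psi> L a) \<mu>) \<and>
      lyapunov_exponent \<psi> (\<epsilon> L) L a \<ge> ereal (\<beta> * ln L - (ln A + 2 * K)))"
  proof eventually_elim
    case (elim L)
    have L: "L \<ge> 2" "L * m \<ge> 2" "L powr \<beta> \<ge> A"
      using elim m by (auto simp: field_simps)
    have pow: "L * L powr (\<beta> - 1) = L powr \<beta>" using L(1) by (simp add: powr_diff)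
    have \<epsilon>: "\<epsilon> L \<ge> C * L powr (\<beta> - 1)" using assms(9) L(1) by simp
    have lower: "C * L powr (\<beta> - 1) > 0" using \<open>C > 0\<close> L(1) by simp
    have "32 \<le> L powr \<beta> * (C * m * \<rho>\<^sup>2)"
      using elim m \<rho> \<open>C > 0\<close> by (simp add: field_simps)
    also have "\<dots> = L * (C * L powr (\<beta> - 1)) * m * \<rho>\<^sup>2"
      by (simp add: pow[symmetric])
    also have "\<dots> \<le> L * \<epsilon> L * m * \<rho>\<^sup>2"
      using \<epsilon> L(1) m by (intro mult_right_mono mult_left_mono) auto
    finally have large: "L * \<epsilon> L * m * \<rho>\<^sup>2 \<ge> 32" .
    define R where "R = L / (1 + 1 / (2 * \<epsilon> L))"
    have R: "R \<ge> L powr \<beta> / A"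
    proof -
      \<comment> \<open>This is where \<open>\<beta> \<le> 1\<close> enters: the summand 1 of the
        density bound is absorbed into a multiple of \<open>L powr (1 - \<beta>)\<close>.\<close>
      have one: "1 \<le> L powr (1 - \<beta>)" using L(1) \<open>\<beta> \<le> 1\<close> by (intro ge_one_powr_ge_zero) auto
      have "1 / (2 * \<epsilon> L) \<le> 1 / (2 * (C * L powr (\<beta> - 1)))"
        using \<epsilon> lower by (intro divide_left_mono) auto
      also have "\<dots> = L powr (1 - \<beta>) * (1 / (2 * C))"
        using L(1) by (simp add: powr_diff field_simps)
      finally have "1 + 1 / (2 * \<epsilon> L) \<le> L powr (1 - \<beta>) * A"
        using one unfolding A_def distrib_left by linarith
      then have "L / (L powr (1 - \<beta>) * A) \<le> R"
        unfolding R_def using \<epsilon> lower L(1) A by (intro divide_left_mono) (auto simp: add_pos_pos)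
      moreover have "L / (L powr (1 - \<beta>) * A) = L powr \<beta> / A"
        using L(1) by (simp add: powr_diff)
      ultimately show ?thesis by simp
    qed
    moreover have "L powr \<beta> / A \<ge> 1" using L(3) A by simp
    ultimately have R1: "R \<ge> 1" by linarith
    have "\<beta> * ln L - ln A = ln (L powr \<beta> / A)"
      using L(1) A by (simp add: ln_div ln_powr)
    also have "\<dots> \<le> ln R" using R R1 L(1) A by (intro ln_mono) auto
    finally have lnR: "\<beta> * ln L - (ln A + 2 * K) \<le> ln R - 2 * K" by simp
    interpret nondegenerate_circle_function \<psi> m \<rho> L
      by unfold_locales (use assms(1) m \<rho> nondeg L in auto)
    have "\<epsilon> L > 0" using \<epsilon> lower by linarith
    note main = unique_ergodic_and_lyapunov_ge[OF this large R_def R1, folded K_def]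
    have "ereal (\<beta> * ln L - (ln A + 2 * K)) \<le> lyapunov_exponent \<psi> (\<epsilon> L) L a" for a
      using main(2)[of a] lnR by (intro order_trans[OF _ main(2)]) simp
    with L(1) main(1) show ?case by blast
  qed
  \<comment> \<open>After division by \<open>ln L\<close> the additive loss
    \<open>ln A + 2 * K\<close> vanishes in the limit.\<close>
  have "((\<lambda>L. \<beta> - (ln A + 2 * K) / ln L) \<longlongrightarrow> \<beta>) at_top"
    by real_asymp
  then have lim: "((\<lambda>L. ereal (\<beta> - (ln A + 2 * K) / ln L)) \<longlongrightarrow> ereal \<beta>) at_top"
    by simp
  have "ereal \<beta> = Liminf at_top (\<lambda>L. ereal (\<beta> - (ln A + 2 * K) / ln L))"
    using lim by (intro lim_imp_Liminf[symmetric]) auto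
  also have "\<dots> \<le> Liminf at_top (\<lambda>L. INF a\<in>{0..<1}. lyapunov_exponent \<psi> (\<epsilon> L) L a / ereal (ln L))"
  proof (rule Liminf_mono, use key in eventually_elim)
    case (elim L)
    have ln: "ln L > 0" using elim by simp
    have "ereal (\<beta> - (ln A + 2 * K) / ln L) \<le> lyapunov_exponent \<psi> (\<epsilon> L) L a / ereal (ln L)" for a
    proof -
      have "ereal (\<beta> - (ln A + 2 * K) / ln L) = ereal (\<beta> * ln L - (ln A + 2 * K)) / ereal (ln L)"
        using ln by (simp add: diff_divide_distrib)
      also have "\<dots> \<le> lyapunov_exponent \<psi> (\<epsilon> L) L a / ereal (ln L)"
        using elim ln by (intro ereal_divide_right_mono) auto
      finally show ?thesis .
    qed
    then show ?case by (intro INF_greatest)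
  qed
  finally have "ereal \<beta> \<le> Liminf at_top (\<lambda>L. INF a\<in>{0..<1}. lyapunov_exponent \<psi> (\<epsilon> L) L a / ereal (ln L))" .
  moreover have "\<forall>\<^sub>F L in at_top. \<forall>a\<in>{0..<1}.
      \<exists>!\<mu>. ergodic_invariant_measure (noise (\<epsilon> L)) (tau_kicked \<psi> L a) \<mu>"
    using key by (rule eventually_mono) blast
  ultimately show ?thesis by blast
qed

end
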